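(* For every integer $n\geq 1$, the special affine group $\mathbb R^n\rtimes SL(n)$ of affine motions of $\mathbb R^n$ whose linear part has determinant $1$ is a contact Lie group.
   Context: $SL(n)=SL(n,\mathbb R)$ acts on $\mathbb R^n$ in the natural way. A Lie group of dimension $2k+1$ is a contact Lie group if it carries a left invariant 1-form $\eta^+$ with $(d\eta^+)^k\wedge\eta^+\neq0$ pointwise. *)

theory Defs
  imports "HOL-Analysis.Analysis" "HOL-Algebra.Group"
begin

section \<open>Smooth maps\<close>

text \<open>Intended for open \<open>S\<close>: all iterated directional derivatives of order at most \<open>k\<close>
  exist on \<open>S\<close> and are continuous.\<close>

primrec Ck_on :: "nat \<Rightarrow> 'a::real_normed_vector set \<Rightarrow> ('a \<Rightarrow> 'b::real_normed_vector) \<Rightarrow> bool"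
  where
    "Ck_on 0 S f \<longleftrightarrow> continuous_on S f"
  | "Ck_on (Suc k) S f \<longleftrightarrow>
       (\<forall>x\<in>S. f differentiable (at x)) \<and>
       (\<forall>v. Ck_on k S (\<lambda>x. frechet_derivative f (at x) v))"

definition Cinf_on :: "'a::real_normed_vector set \<Rightarrow> ('a \<Rightarrow> 'b::real_normed_vector) \<Rightarrow> bool"
  where "Cinf_on S f \<longleftrightarrow> (\<forall>k. Ck_on k S f)"

text \<open>Smoothness on an arbitrary subset of a Euclidean space, via local smooth extensions. On an
  embedded submanifold this is smoothness with respect to the induced manifold structure.\<close>

definition smooth_map_on :: "'a::real_normed_vector set \<Rightarrow> ('a \<Rightarrow> 'b::real_normed_vector) \<Rightarrow> bool"
  where "smooth_map_on S f \<longleftrightarrow>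
    (\<forall>x\<in>S. \<exists>U g. open U \<and> x \<in> U \<and> Cinf_on U g \<and> (\<forall>y\<in>S \<inter> U. g y = f y))"

section \<open>Embedded submanifolds\<close>

text \<open>Manifolds are taken as embedded submanifolds of a Euclidean space, described by slice charts.
  By Whitney's embedding theorem this is no restriction.\<close>

definition embedded_submanifold :: "nat \<Rightarrow> 'a::euclidean_space set \<Rightarrow> bool"
  where "embedded_submanifold d M \<longleftrightarrow>
    (\<forall>p\<in>M. \<exists>U V \<phi> \<psi> (L :: 'a set).
       open U \<and> p \<in> U \<and> open V \<and> homeomorphism U V \<phi> \<psi> \<and> Cinf_on U \<phi> \<and> Cinf_on V \<psi> \<and>
       subspace L \<and> dim L = d \<and> \<phi> ` (M \<inter> U) = L \<inter> V)"

definition smooth_curve_through :: "'a::euclidean_space set \<Rightarrow> 'a \<Rightarrow> (real \<Rightarrow> 'a) \<Rightarrow> bool"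
  where "smooth_curve_through M p \<gamma> \<longleftrightarrow>
    (\<exists>\<epsilon>>0. Cinf_on {-\<epsilon><..<\<epsilon>} \<gamma> \<and> \<gamma> ` {-\<epsilon><..<\<epsilon>} \<subseteq> M) \<and> \<gamma> 0 = p"

definition tangent_space :: "'a::euclidean_space set \<Rightarrow> 'a \<Rightarrow> 'a set"
  where "tangent_space M p =
    {vector_derivative \<gamma> (at 0) | \<gamma>. smooth_curve_through M p \<gamma>}"

section \<open>Differential forms\<close>

text \<open>An \<open>r\<close>-form at a point is a function of \<open>r\<close> tangent vectors, represented as a function of a
  sequence of vectors that depends only on the entries with index less than \<open>r\<close>.\<close>

type_synonym 'a alt_form = "(nat \<Rightarrow> 'a) \<Rightarrow> real"

definition wedge :: "nat \<Rightarrow> nat \<Rightarrow> 'a alt_form \<Rightarrow> 'a alt_form \<Rightarrow> 'a alt_form"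
  where "wedge r s \<alpha> \<beta> = (\<lambda>v.
    (\<Sum>\<sigma> | \<sigma> permutes {..<r + s}.
       of_int (sign \<sigma>) * \<alpha> (\<lambda>i. v (\<sigma> i)) * \<beta> (\<lambda>i. v (\<sigma> (r + i)))) / (fact r * fact s))"

primrec wedge_power :: "nat \<Rightarrow> 'a alt_form \<Rightarrow> nat \<Rightarrow> 'a alt_form"
  where
    "wedge_power r \<alpha> 0 = (\<lambda>v. 1)"
  | "wedge_power r \<alpha> (Suc k) = wedge r (r * k) \<alpha> (wedge_power r \<alpha> k)"

definition smooth_1form_on_open :: "'a::euclidean_space set \<Rightarrow> ('a \<Rightarrow> 'a \<Rightarrow> real) \<Rightarrow> bool"
  where "smooth_1form_on_open U \<omega> \<longleftrightarrow>
    open U \<and> (\<forall>x\<in>U. linear (\<omega> x)) \<and> (\<forall>v. Cinf_on U (\<lambda>x. \<omega> x v))"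

text \<open>The formula \<open>d\<omega>(X,Y) = X(\<omega>(Y)) - Y(\<omega>(X)) - \<omega>([X,Y])\<close> for constant vector fields
  \<open>X = v 0\<close>, \<open>Y = v 1\<close>.\<close>

definition ext_deriv_1form :: "('a::euclidean_space \<Rightarrow> 'a \<Rightarrow> real) \<Rightarrow> 'a \<Rightarrow> 'a alt_form"
  where "ext_deriv_1form \<omega> p = (\<lambda>v.
    frechet_derivative (\<lambda>x. \<omega> x (v 1)) (at p) (v 0) -
    frechet_derivative (\<lambda>x. \<omega> x (v 0)) (at p) (v 1))"

text \<open>A 1-form \<open>\<eta>\<close> on a submanifold \<open>M\<close> matters only through the values \<open>\<eta> p v\<close> with \<open>p \<in> M\<close>
  and \<open>v\<close> tangent to \<open>M\<close> at \<open>p\<close>. The following says that \<open>\<eta>\<close> is, near \<open>p\<close>, the restriction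
  of \<open>\<omega>\<close> to \<open>M\<close>.\<close>

definition local_extension ::
  "'a::euclidean_space set \<Rightarrow> ('a \<Rightarrow> 'a \<Rightarrow> real) \<Rightarrow> 'a \<Rightarrow> 'a set \<Rightarrow> ('a \<Rightarrow> 'a \<Rightarrow> real) \<Rightarrow> bool"
  where "local_extension M \<eta> p U \<omega> \<longleftrightarrow>
    p \<in> U \<and> smooth_1form_on_open U \<omega> \<and>
    (\<forall>x\<in>M \<inter> U. \<forall>v\<in>tangent_space M x. \<omega> x v = \<eta> x v)"

definition smooth_1form_on :: "'a::euclidean_space set \<Rightarrow> ('a \<Rightarrow> 'a \<Rightarrow> real) \<Rightarrow> bool"
  where "smooth_1form_on M \<eta> \<longleftrightarrow> (\<forall>p\<in>M. \<exists>U \<omega>. local_extension M \<eta> p U \<omega>)"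

text \<open>Pullback along the inclusion \<open>\<iota>\<close> of \<open>M\<close> commutes with the exterior derivative, so
  \<open>d\<eta> = \<iota>\<^sup>* d\<omega>\<close> for every local extension \<open>\<omega>\<close> of \<open>\<eta>\<close>. Hence \<open>\<theta>\<close> below is uniquely determined
  on the tangent spaces of \<open>M\<close>.\<close>

definition has_ext_deriv ::
  "'a::euclidean_space set \<Rightarrow> ('a \<Rightarrow> 'a \<Rightarrow> real) \<Rightarrow> ('a \<Rightarrow> 'a alt_form) \<Rightarrow> bool"
  where "has_ext_deriv M \<eta> \<theta> \<longleftrightarrow>
    (\<forall>p\<in>M. \<exists>U \<omega>. local_extension M \<eta> p U \<omega> \<and>
       (\<forall>v. v 0 \<in> tangent_space M p \<and> v 1 \<in> tangent_space M p \<longrightarrow>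
          \<theta> p v = ext_deriv_1form \<omega> p v))"

definition nonzero_form_at :: "'a::euclidean_space set \<Rightarrow> 'a \<Rightarrow> nat \<Rightarrow> 'a alt_form \<Rightarrow> bool"
  where "nonzero_form_at M p r \<alpha> \<longleftrightarrow> (\<exists>v. (\<forall>i<r. v i \<in> tangent_space M p) \<and> \<alpha> v \<noteq> 0)"

section \<open>Contact Lie groups\<close>

definition lie_group :: "nat \<Rightarrow> ('a::euclidean_space, 'b) monoid_scheme \<Rightarrow> bool"
  where "lie_group d G \<longleftrightarrow>
    group G \<and> embedded_submanifold d (carrier G) \<and>
    smooth_map_on (carrier G \<times> carrier G) (\<lambda>(x, y). x \<otimes>\<^bsub>G\<^esub> y) \<and>
    smooth_map_on (carrier G) (\<lambda>x. inv\<^bsub>G\<^esub> x)"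

text \<open>\<open>L\<^sub>g\<^sup>* \<eta> = \<eta>\<close> for all left translations \<open>L\<^sub>g\<close>, whose differential at \<open>p\<close> maps the velocity of
  a curve \<open>\<gamma>\<close> through \<open>p\<close> to the velocity of \<open>L\<^sub>g \<circ> \<gamma>\<close>.\<close>

definition left_invariant_1form ::
  "('a::euclidean_space, 'b) monoid_scheme \<Rightarrow> ('a \<Rightarrow> 'a \<Rightarrow> real) \<Rightarrow> bool"
  where "left_invariant_1form G \<eta> \<longleftrightarrow>
    (\<forall>g\<in>carrier G. \<forall>p\<in>carrier G. \<forall>\<gamma>. smooth_curve_through (carrier G) p \<gamma> \<longrightarrow>
       \<eta> (g \<otimes>\<^bsub>G\<^esub> p) (vector_derivative (\<lambda>t. g \<otimes>\<^bsub>G\<^esub> \<gamma> t) (at 0)) =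
       \<eta> p (vector_derivative \<gamma> (at 0)))"

definition contact_lie_group :: "('a::euclidean_space, 'b) monoid_scheme \<Rightarrow> bool"
  where "contact_lie_group G \<longleftrightarrow>
    (\<exists>k. lie_group (2 * k + 1) G \<and>
      (\<exists>\<eta> \<theta>. smooth_1form_on (carrier G) \<eta> \<and> left_invariant_1form G \<eta> \<and>
         has_ext_deriv (carrier G) \<eta> \<theta> \<and>
         (\<forall>p\<in>carrier G. nonzero_form_at (carrier G) p (2 * k + 1)
            (wedge (2 * k) 1 (wedge_power 2 (\<theta> p) k) (\<lambda>v. \<eta> p (v 0))))))"

section \<open>The special affine group\<close>

text \<open>The pair \<open>(b, A)\<close> stands for the affine motion \<open>x \<mapsto> A x + b\<close>.\<close>

definition affine_motion :: "(real ^ 'n) \<times> (real ^ 'n ^ 'n) \<Rightarrow> real ^ 'n \<Rightarrow> real ^ 'n"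
  where "affine_motion g x = snd g *v x + fst g"

definition special_affine_group :: "((real ^ 'n) \<times> (real ^ 'n ^ 'n)) monoid"
  where "special_affine_group =
    \<lparr>carrier = {(b, A). det A = 1},
     monoid.mult = (\<lambda>(b, A) (c, B). (b + A *v c, A ** B)),
     one = (0, mat 1)\<rparr>"

lemma affine_motion_mult:
  "affine_motion (g \<otimes>\<^bsub>special_affine_group\<^esub> h) = affine_motion g \<circ> affine_motion h"
  by (auto simp: fun_eq_iff affine_motion_def special_affine_group_def case_prod_unfold
      matrix_vector_right_distrib matrix_vector_mul_assoc)

lemma affine_motion_one: "affine_motion \<one>\<^bsub>special_affine_group\<^esub> = id"
  by (auto simp: fun_eq_iff affine_motion_def special_affine_group_def)

lemma inj_affine_motion: "inj affine_motion"
proof (rule injI)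
  fix g h :: "(real ^ 'n) \<times> (real ^ 'n ^ 'n)"
  assume eq: "affine_motion g = affine_motion h"
  have b: "fst g = fst h"
    using fun_cong[OF eq, of 0] by (simp add: affine_motion_def)
  have "snd g *v x = snd h *v x" for x
    using fun_cong[OF eq, of x] b by (simp add: affine_motion_def)
  then have "snd g = snd h"
    by (simp add: matrix_eq)
  with b show "g = h"
    by (simp add: prod_eq_iff)
qed

end

theory Submission
  imports Defs
begin

text \<open>
  A left invariant 1-form on a Lie group is a linear functional \<open>\<alpha>\<close> on its Lie algebra, and its
  exterior derivative is the left invariant 2-form given by \<open>\<Omega>(X, Y) = - \<alpha>([X, Y])\<close>. The form is
  a contact form as soon as the radical of \<open>\<Omega>\<close> is a line on which \<open>\<alpha>\<close> does not vanish: then \<open>\<Omega>\<close>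
  is nondegenerate on the kernel of \<open>\<alpha>\<close>, and the form \<open>\<Omega>\<^sup>k \<and> \<alpha>\<close> is nonzero on a symplectic basis
  of that kernel followed by a vector of the radical.

  The Lie algebra of the special affine group consists of the pairs \<open>(b, A)\<close> with \<open>trace A = 0\<close>,
  and the bracket of \<open>(b, A)\<close> and \<open>(c, B)\<close> is \<open>(A c - B b, A B - B A)\<close>. The functional is
  \<open>\<alpha>(b, A) = \<Sum>i. b\<^sub>i + \<Sum>i. m\<^sub>i A\<^sub>i\<^sub>i\<close> with pairwise distinct reals \<open>m\<^sub>i\<close>. Because \<open>ad\<close> of the
  diagonal matrix with entries \<open>m\<^sub>i\<close> is diagonal on the matrix units, with the nonzero eigenvalues
  \<open>m\<^sub>i - m\<^sub>j\<close> off the diagonal, the equations for the radical can be solved entry by entry: pairing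
  with matrix units shows that \<open>b\<close> is a constant vector \<open>s (1, \<dots>, 1)\<close> and that the off-diagonal
  entries of \<open>A\<close> are \<open>s / (m\<^sub>i - m\<^sub>j)\<close>; pairing with translations shows that the columns of \<open>A\<close> sum
  to zero, which gives the diagonal (\<open>bracket_form_radical\<close>, \<open>reeb_radical\<close>). The value of \<open>\<alpha>\<close> on
  the resulting vector with \<open>s = 1\<close> is \<open>n (n + 1) / 2\<close>, and so it is positive
  (\<open>inner_reeb_covector_pos\<close>).

  Nondegeneracy produces a symplectic basis (\<open>symplectic_basis_exists\<close>), and the existence of such
  a basis also shows that the dimension of the group is odd. The iterated wedge product is evaluated
  on the basis through a formula summing over all permutations (\<open>wedge_power_2form\<close>), in which no
  two terms can cancel (\<open>darboux_sign_nonneg\<close>).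

  For the differential geometry, the equation \<open>det A = 1\<close> is affine in each single matrix entry.
  Replacing an entry with nonzero cofactor by \<open>det A - 1\<close> is therefore a slice chart with a rational
  inverse. Near the group the form is \<open>(c, B) \<mapsto> \<alpha>(A\<^sup>-\<^sup>1 c, A\<^sup>-\<^sup>1 B)\<close> at \<open>(b, A)\<close>, which is defined
  wherever \<open>det A \<noteq> 0\<close>, and the derivative of the matrix inverse turns its exterior derivative into
  the bracket formula (\<open>ext_deriv_left_invariant_form\<close>).
\<close>

section \<open>Calculus of smooth maps\<close>

lemma Ck_on_cong:
  assumes "open S" "\<And>x. x \<in> S \<Longrightarrow> f x = g x" "Ck_on k S f"
  shows "Ck_on k S g"
  using assms(2,3)
proof (induction k arbitrary: f g)
  case 0
  then show ?case by (metis Ck_on.simps(1) continuous_on_cong)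
next
  case (Suc k)
  have d: "(g has_derivative frechet_derivative f (at x)) (at x)" if "x \<in> S" for x
  proof (rule has_derivative_transform_within_open[OF _ \<open>open S\<close> that])
    show "(f has_derivative frechet_derivative f (at x)) (at x)"
      using Suc.prems(2) that by (simp add: frechet_derivative_works)
  qed (use Suc.prems in auto)
  have "Ck_on k S (\<lambda>x. frechet_derivative g (at x) v)" for v
    by (rule Suc.IH[of "\<lambda>x. frechet_derivative f (at x) v"])
      (use Suc.prems d in \<open>auto simp: frechet_derivative_at[OF d]\<close>)
  then show ?case
    using d by (auto simp: differentiable_def)
qed

text \<open>Smoothness is defined through the choice function \<open>frechet_derivative\<close>. This rule
  lets an explicit derivative take its place, so that the closure properties below follow by
  induction on the order from the usual differentiation rules.\<close>

lemma Ck_on_SucI: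
  assumes "open S" "\<And>x. x \<in> S \<Longrightarrow> (f has_derivative f' x) (at x)"
    and "\<And>v. Ck_on k S (\<lambda>x. f' x v)"
  shows "Ck_on (Suc k) S f"
proof -
  have "Ck_on k S (\<lambda>x. frechet_derivative f (at x) v)" for v
    by (rule Ck_on_cong[OF assms(1) _ assms(3)[of v]]) (simp add: frechet_derivative_at[OF assms(2)])
  then show ?thesis
    using assms(2) by (auto simp: differentiable_def)
qed

lemma Ck_on_Suc_has_derivative:
  assumes "Ck_on (Suc k) S f" "x \<in> S"
  shows "(f has_derivative frechet_derivative f (at x)) (at x)"
  using assms by (simp add: frechet_derivative_works)

lemma Ck_on_Suc_imp: "Ck_on (Suc k) S f \<Longrightarrow> Ck_on k S f"
proof (induction k arbitrary: f)
  case 0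
  then show ?case
    by (auto intro!: continuous_at_imp_continuous_on differentiable_imp_continuous_within)
next
  case (Suc k)
  then show ?case by auto
qed

lemma Ck_on_const: "Ck_on k S (\<lambda>x. c)"
  by (induction k arbitrary: c) auto

lemma Ck_on_linear_compose:
  assumes "open S" "bounded_linear h" "Ck_on k S f"
  shows "Ck_on k S (\<lambda>x. h (f x))"
  using assms(3)
proof (induction k arbitrary: f)
  case 0
  then show ?case
    using assms(2) by (auto intro: bounded_linear.continuous_on)
next
  case (Suc k)
  show ?case
    by (rule Ck_on_SucI[OF \<open>open S\<close>
          bounded_linear.has_derivative[OF assms(2) Ck_on_Suc_has_derivative[OF Suc.prems]]])
      (use Suc in auto)
qed

lemma Ck_on_add:
  assumes "open S" "Ck_on k S f" "Ck_on k S g"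
  shows "Ck_on k S (\<lambda>x. f x + g x)"
  using assms(2,3)
proof (induction k arbitrary: f g)
  case 0
  then show ?case by (auto intro: continuous_on_add)
next
  case (Suc k)
  show ?case
    by (rule Ck_on_SucI[OF \<open>open S\<close> has_derivative_add[OF Ck_on_Suc_has_derivative[OF Suc.prems(1)]
            Ck_on_Suc_has_derivative[OF Suc.prems(2)]]])
      (use Suc in auto)
qed

lemma Ck_on_bilinear:
  assumes "open S" "bounded_bilinear h" "Ck_on k S f" "Ck_on k S g"
  shows "Ck_on k S (\<lambda>x. h (f x) (g x))"
  using assms(3,4)
proof (induction k arbitrary: f g)
  case 0
  then show ?case using assms(2) by (auto intro: bounded_bilinear.continuous_on)
next
  case (Suc k)
  have k: "Ck_on k S f" "Ck_on k S g"
    using Suc.prems Ck_on_Suc_imp by blast+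
  have *: "Ck_on k S (\<lambda>x. h (f x) (frechet_derivative g (at x) v) + h (frechet_derivative f (at x) v) (g x))" for v
    using Suc.prems by (intro Ck_on_add \<open>open S\<close> Suc.IH k) auto
  show ?case
    by (rule Ck_on_SucI[OF \<open>open S\<close> bounded_bilinear.FDERIV[OF assms(2)
            Ck_on_Suc_has_derivative[OF Suc.prems(1)]
            Ck_on_Suc_has_derivative[OF Suc.prems(2)]]]) (use * in auto)
qed

lemma Ck_on_inverse:
  fixes f :: "'a::real_normed_vector \<Rightarrow> real"
  assumes "open S" "\<And>x. x \<in> S \<Longrightarrow> f x \<noteq> 0" "Ck_on k S f"
  shows "Ck_on k S (\<lambda>x. inverse (f x))"
  using assms(3)
proof (induction k)
  case 0
  then show ?case using assms(2) by (auto intro: continuous_on_inverse)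
next
  case (Suc k)
  have inv: "Ck_on k S (\<lambda>x. inverse (f x))"
    using Suc Ck_on_Suc_imp by blast
  have df: "Ck_on k S (\<lambda>x. frechet_derivative f (at x) v)" for v
    using Suc.prems by simp
  have "Ck_on k S (\<lambda>x. - (inverse (f x) * frechet_derivative f (at x) v * inverse (f x)))" for v
    by (intro Ck_on_linear_compose[OF \<open>open S\<close> bounded_linear_minus[OF bounded_linear_ident]]
        Ck_on_bilinear[OF \<open>open S\<close> bounded_bilinear_mult] inv df)
  then show ?case
    by (intro Ck_on_SucI[OF \<open>open S\<close> Deriv.has_derivative_inverse[OF _ Ck_on_Suc_has_derivative[OF Suc.prems]]])
      (use assms(2) in auto)
qed

lemma Cinf_on_cong:
  "open S \<Longrightarrow> (\<And>x. x \<in> S \<Longrightarrow> f x = g x) \<Longrightarrow> Cinf_on S f \<Longrightarrow> Cinf_on S g"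
  unfolding Cinf_on_def using Ck_on_cong by blast

lemma Cinf_on_const: "Cinf_on S (\<lambda>x. c)"
  by (simp add: Cinf_on_def Ck_on_const)

lemma Cinf_on_linear_compose:
  "open S \<Longrightarrow> bounded_linear h \<Longrightarrow> Cinf_on S f \<Longrightarrow> Cinf_on S (\<lambda>x. h (f x))"
  by (simp add: Cinf_on_def Ck_on_linear_compose)

lemma Cinf_on_ident:
  assumes "open S" shows "Cinf_on S (\<lambda>x. x)"
  unfolding Cinf_on_def
proof
  fix k show "Ck_on k S (\<lambda>x. x)"
    by (cases k) (auto intro!: Ck_on_const)
qed

lemma Cinf_on_add: "open S \<Longrightarrow> Cinf_on S f \<Longrightarrow> Cinf_on S g \<Longrightarrow> Cinf_on S (\<lambda>x. f x + g x)"
  by (simp add: Cinf_on_def Ck_on_add)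

lemma Cinf_on_bilinear:
  "open S \<Longrightarrow> bounded_bilinear h \<Longrightarrow> Cinf_on S f \<Longrightarrow> Cinf_on S g \<Longrightarrow> Cinf_on S (\<lambda>x. h (f x) (g x))"
  by (simp add: Cinf_on_def Ck_on_bilinear)

lemma Cinf_on_mult:
  fixes f :: "'a::real_normed_vector \<Rightarrow> real"
  shows "open S \<Longrightarrow> Cinf_on S f \<Longrightarrow> Cinf_on S g \<Longrightarrow> Cinf_on S (\<lambda>x. f x * g x)"
  by (rule Cinf_on_bilinear[OF _ bounded_bilinear_mult])

lemma Cinf_on_uminus: "open S \<Longrightarrow> Cinf_on S f \<Longrightarrow> Cinf_on S (\<lambda>x. - f x)"
  by (rule Cinf_on_linear_compose[OF _ bounded_linear_minus[OF bounded_linear_ident]])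

lemma Cinf_on_diff: "open S \<Longrightarrow> Cinf_on S f \<Longrightarrow> Cinf_on S g \<Longrightarrow> Cinf_on S (\<lambda>x. f x - g x)"
  using Cinf_on_add[OF _ _ Cinf_on_uminus] by fastforce

lemma Cinf_on_divide:
  fixes f :: "'a::real_normed_vector \<Rightarrow> real"
  assumes "open S" "\<And>x. x \<in> S \<Longrightarrow> g x \<noteq> 0" "Cinf_on S f" "Cinf_on S g"
  shows "Cinf_on S (\<lambda>x. f x / g x)"
  unfolding divide_inverse
  by (rule Cinf_on_mult) (use assms in \<open>auto simp: Cinf_on_def Ck_on_inverse\<close>)

lemma Cinf_on_sum:
  assumes "open S" "\<And>i. i \<in> I \<Longrightarrow> Cinf_on S (f i)"
  shows "Cinf_on S (\<lambda>x. \<Sum>i\<in>I. f i x)"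
  using assms(2)
  by (induction I rule: infinite_finite_induct) (auto intro: Cinf_on_const Cinf_on_add[OF assms(1)])

lemma Cinf_on_prod:
  fixes f :: "'i \<Rightarrow> 'a::real_normed_vector \<Rightarrow> real"
  assumes "open S" "\<And>i. i \<in> I \<Longrightarrow> Cinf_on S (f i)"
  shows "Cinf_on S (\<lambda>x. \<Prod>i\<in>I. f i x)"
  using assms(2)
  by (induction I rule: infinite_finite_induct) (auto intro: Cinf_on_const Cinf_on_mult[OF assms(1)])

lemma bounded_linear_axis: "bounded_linear (axis i :: 'a::euclidean_space \<Rightarrow> 'a ^ 'n)"
  by (rule linear_conv_bounded_linear[THEN iffD1], rule linearI) (auto simp: vec_eq_iff axis_def)

lemma Cinf_on_vec:
  fixes f :: "'a::real_normed_vector \<Rightarrow> 'b::euclidean_space ^ 'n"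
  assumes "open S" "\<And>i. Cinf_on S (\<lambda>x. f x $ i)"
  shows "Cinf_on S f"
proof -
  have "f = (\<lambda>x. \<Sum>i\<in>UNIV. axis i (f x $ i))"
    by (auto simp: fun_eq_iff vec_eq_iff axis_def)
  moreover have "Cinf_on S (\<lambda>x. \<Sum>i\<in>UNIV. axis i (f x $ i))"
    by (intro Cinf_on_sum Cinf_on_linear_compose[OF _ bounded_linear_axis] assms)
  ultimately show ?thesis by simp
qed

lemma Cinf_on_Pair:
  assumes "open S" "Cinf_on S f" "Cinf_on S g"
  shows "Cinf_on S (\<lambda>x. (f x, g x))"
proof -
  have "Cinf_on S (\<lambda>x. (f x, 0) + (0, g x))"
    by (rule Cinf_on_add[OF assms(1)])
      (use assms in \<open>auto intro!: Cinf_on_linear_compose[OF assms(1), of "\<lambda>y. (y, 0)"]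
        Cinf_on_linear_compose[OF assms(1), of "\<lambda>y. (0, y)"]
        bounded_linear_Pair bounded_linear_zero bounded_linear_ident\<close>)
  then show ?thesis by simp
qed

lemma Cinf_on_fst: "open S \<Longrightarrow> Cinf_on S f \<Longrightarrow> Cinf_on S (\<lambda>x. fst (f x))"
  by (rule Cinf_on_linear_compose[OF _ bounded_linear_fst])

lemma Cinf_on_snd: "open S \<Longrightarrow> Cinf_on S f \<Longrightarrow> Cinf_on S (\<lambda>x. snd (f x))"
  by (rule Cinf_on_linear_compose[OF _ bounded_linear_snd])

lemma Cinf_on_nth:
  fixes f :: "'a::real_normed_vector \<Rightarrow> 'b::real_normed_vector ^ 'n"
  shows "open S \<Longrightarrow> Cinf_on S f \<Longrightarrow> Cinf_on S (\<lambda>x. f x $ i)"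
  by (rule Cinf_on_linear_compose[OF _ bounded_linear_vec_nth])

lemma Cinf_on_matrix_vector_mult:
  fixes A :: "'a::real_normed_vector \<Rightarrow> real ^ 'n ^ 'm"
  assumes "open S" "Cinf_on S A" "Cinf_on S b"
  shows "Cinf_on S (\<lambda>x. A x *v b x)"
  by (rule Cinf_on_vec)
    (use assms in \<open>auto simp: matrix_vector_mult_def intro!: Cinf_on_sum Cinf_on_mult Cinf_on_nth\<close>)

lemma Cinf_on_det:
  fixes A :: "'a::real_normed_vector \<Rightarrow> real ^ 'n ^ 'n"
  assumes "open S" "Cinf_on S A"
  shows "Cinf_on S (\<lambda>x. det (A x))"
  unfolding det_def
  using assms by (auto intro!: Cinf_on_sum Cinf_on_mult Cinf_on_prod Cinf_on_const Cinf_on_nth)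

lemma Cinf_on_has_derivative:
  "Cinf_on S f \<Longrightarrow> x \<in> S \<Longrightarrow> (f has_derivative frechet_derivative f (at x)) (at x)"
  unfolding Cinf_on_def by (rule Ck_on_Suc_has_derivative) auto

lemma Cinf_on_continuous_on: "Cinf_on S f \<Longrightarrow> continuous_on S f"
  unfolding Cinf_on_def by (metis Ck_on.simps(1))

section \<open>The matrix inverse\<close>

lemma matrix_inv_cancel:
  fixes A :: "real ^ 'n ^ 'n"
  assumes "det A \<noteq> 0"
  shows "A ** matrix_inv A = mat 1" "matrix_inv A ** A = mat 1"
proof -
  have "\<exists>B. A ** B = mat 1 \<and> B ** A = mat 1"
    using assms by (simp add: invertible_det_nz[symmetric] invertible_def)
  from someI_ex[OF this] show "A ** matrix_inv A = mat 1" "matrix_inv A ** A = mat 1"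
    by (simp_all add: matrix_inv_def)
qed

text \<open>Cramer's rule for the columns of the inverse. It exhibits each entry as a quotient of
  polynomials, which is where smoothness of the inverse comes from.\<close>

lemma matrix_inv_entry:
  fixes A :: "real ^ 'n ^ 'n"
  assumes "det A \<noteq> 0"
  shows "matrix_inv A $ k $ l = det (\<chi> i j. if j = k then axis l 1 $ i else A $ i $ j) / det A"
proof -
  have "A *v (matrix_inv A *v axis l 1) = axis l 1"
    using assms by (simp add: matrix_vector_mul_assoc matrix_inv_cancel)
  then have "matrix_inv A *v axis l 1 =
      (\<chi> k. det (\<chi> i j. if j = k then axis l 1 $ i else A $ i $ j) / det A)"
    by (simp add: cramer[OF assms])
  then have "(matrix_inv A *v axis l 1) $ k =
      det (\<chi> i j. if j = k then axis l 1 $ i else A $ i $ j) / det A"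
    by simp
  then show ?thesis
    by (simp add: matrix_vector_mul_component inner_axis)
qed

lemma Cinf_on_matrix_inv:
  fixes A :: "'a::real_normed_vector \<Rightarrow> real ^ 'n ^ 'n"
  assumes "open S" "Cinf_on S A" "\<And>x. x \<in> S \<Longrightarrow> det (A x) \<noteq> 0"
  shows "Cinf_on S (\<lambda>x. matrix_inv (A x))"
proof (intro Cinf_on_vec \<open>open S\<close>)
  fix k l
  have "Cinf_on S (\<lambda>x. (\<chi> i j. if j = k then axis l 1 $ i else A x $ i $ j) :: real ^ 'n ^ 'n)"
  proof (intro Cinf_on_vec \<open>open S\<close>)
    fix i j
    show "Cinf_on S (\<lambda>x. ((\<chi> i j. if j = k then axis l 1 $ i else A x $ i $ j) :: real ^ 'n ^ 'n) $ i $ j)"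
      using assms by (cases "j = k") (auto intro!: Cinf_on_const Cinf_on_nth)
  qed
  then have "Cinf_on S (\<lambda>x. det (\<chi> i j. if j = k then axis l 1 $ i else A x $ i $ j) / det (A x))"
    using assms by (intro Cinf_on_divide Cinf_on_det) auto
  then show "Cinf_on S (\<lambda>x. matrix_inv (A x) $ k $ l)"
    by (rule Cinf_on_cong[OF \<open>open S\<close>, rotated]) (simp add: matrix_inv_entry assms(3))
qed

lemma continuous_on_det:
  fixes A :: "'a::real_normed_vector \<Rightarrow> real ^ 'n ^ 'n"
  assumes "continuous_on S A"
  shows "continuous_on S (\<lambda>x. det (A x))"
  unfolding det_def by (intro continuous_intros assms)

lemma matrix_inv_unique:
  fixes A B :: "real ^ 'n ^ 'n"
  assumes "A ** B = mat 1"
  shows "matrix_inv A = B"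
proof -
  have "det A * det B = 1"
    using assms det_mul[of A B] by simp
  then have "det A \<noteq> 0" by auto
  then have "matrix_inv A ** (A ** B) = B"
    by (simp add: matrix_mul_assoc matrix_inv_cancel)
  then show ?thesis by (simp add: assms)
qed

lemma matrix_inv_mult:
  fixes A B :: "real ^ 'n ^ 'n"
  assumes "det A \<noteq> 0" "det B \<noteq> 0"
  shows "matrix_inv (A ** B) = matrix_inv B ** matrix_inv A"
proof (rule matrix_inv_unique)
  have "A ** B ** (matrix_inv B ** matrix_inv A) = A ** (B ** matrix_inv B) ** matrix_inv A"
    by (simp add: matrix_mul_assoc)
  then show "A ** B ** (matrix_inv B ** matrix_inv A) = mat 1"
    by (simp add: matrix_inv_cancel assms)
qed

lemma bounded_bilinear_matrix_mult:
  "bounded_bilinear ((**) :: real ^ 'n ^ 'n \<Rightarrow> real ^ 'n ^ 'n \<Rightarrow> real ^ 'n ^ 'n)"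
proof -
  have "bilinear ((**) :: real ^ 'n ^ 'n \<Rightarrow> real ^ 'n ^ 'n \<Rightarrow> real ^ 'n ^ 'n)"
    unfolding bilinear_def
    by (intro conjI allI linearI)
      (simp_all add: vec_eq_iff matrix_matrix_mult_def sum_distrib_left sum.distrib ring_distribs mult_ac)
  then show ?thesis by (simp add: bilinear_conv_bounded_bilinear)
qed

lemma open_det_nonzero: "open {A :: real ^ 'n ^ 'n. det A \<noteq> 0}"
  by (intro open_Collect_neq continuous_on_det continuous_intros)

lemma open_snd_det_nonzero: "open {x :: (real ^ 'n) \<times> (real ^ 'n ^ 'n). det (snd x) \<noteq> 0}"
  by (intro open_Collect_neq continuous_on_det continuous_intros)

text \<open>Smoothness supplies some derivative; differentiating \<open>X ** matrix_inv X = mat 1\<close> then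
  determines it.\<close>

lemma has_derivative_matrix_inv:
  fixes A :: "real ^ 'n ^ 'n"
  assumes "det A \<noteq> 0"
  shows "(matrix_inv has_derivative (\<lambda>H. - (matrix_inv A ** H ** matrix_inv A))) (at A)"
proof -
  let ?U = "{A :: real ^ 'n ^ 'n. det A \<noteq> 0}"
  have "Cinf_on ?U (\<lambda>A. matrix_inv A)"
    by (intro Cinf_on_matrix_inv open_det_nonzero Cinf_on_ident) auto
  then obtain J' where J': "(matrix_inv has_derivative J') (at A)"
    using Cinf_on_has_derivative assms by blast
  have "((\<lambda>X. X ** matrix_inv X) has_derivative (\<lambda>H. A ** J' H + H ** matrix_inv A)) (at A)"
    by (rule bounded_bilinear.FDERIV[OF bounded_bilinear_matrix_mult has_derivative_ident J'])
  moreover have "((\<lambda>X. X ** matrix_inv X) has_derivative (\<lambda>H. 0)) (at A)"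
    by (rule has_derivative_transform_within_open[OF has_derivative_const[of "mat 1"] open_det_nonzero])
      (use assms in \<open>auto simp: matrix_inv_cancel\<close>)
  ultimately have "(\<lambda>H. A ** J' H + H ** matrix_inv A) = (\<lambda>H. 0)"
    by (rule has_derivative_unique)
  then have eq: "A ** J' H = - (H ** matrix_inv A)" for H
    by (metis add_eq_0_iff2)
  have "J' H = - (matrix_inv A ** H ** matrix_inv A)" for H
  proof -
    have "J' H = matrix_inv A ** (A ** J' H)"
      by (simp add: matrix_mul_assoc matrix_inv_cancel assms)
    also have "\<dots> = - (matrix_inv A ** H ** matrix_inv A)"
      unfolding eq
      by (simp add: matrix_mul_assoc bounded_bilinear.minus_right[OF bounded_bilinear_matrix_mult])
    finally show ?thesis .
  qed
  then show ?thesis using J' by presburger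
qed

section \<open>Wedge products as sums over permutations\<close>

lemma permutation_lessThan: "\<sigma> permutes {..<n::nat} \<Longrightarrow> permutation \<sigma>"
  by (auto simp: permutation_permutes)

lemma sum_permutes_compose_right:
  assumes "\<rho> permutes S"
  shows "(\<Sum>\<sigma> | \<sigma> permutes S. g (\<sigma> \<circ> \<rho>)) = (\<Sum>\<sigma> | \<sigma> permutes S. g \<sigma>)"
  by (rule sum.reindex_bij_witness[of _ "\<lambda>\<sigma>. \<sigma> \<circ> inv_into UNIV \<rho>" "\<lambda>\<sigma>. \<sigma> \<circ> \<rho>"])
    (use assms in \<open>auto simp: permutes_inv_o[OF assms] comp_assoc intro: permutes_compose permutes_inv\<close>)

text \<open>When a factor of a wedge product is itself the alternation of some \<open>F\<close>, its inner
  permutations can be absorbed into the outer ones: each contributes the same sum, and their number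
  cancels one of the factorials. For the right factor, in \<open>wedge_alternation_right\<close>, the inner
  permutations have to be shifted past the first \<open>r\<close> arguments.\<close>

lemma wedge_alternation_left:
  assumes "\<And>u. \<alpha> u = c * (\<Sum>\<tau> | \<tau> permutes {..<r}. of_int (sign \<tau>) * F (\<lambda>i. u (\<tau> i)))"
  shows "wedge r s \<alpha> \<beta> v = c / fact s *
    (\<Sum>\<sigma> | \<sigma> permutes {..<r + s}. of_int (sign \<sigma>) * F (\<lambda>i. v (\<sigma> i)) * \<beta> (\<lambda>i. v (\<sigma> (r + i))))"
    (is "_ = _ * ?R")
proof -
  let ?g = "\<lambda>\<sigma>. of_int (sign \<sigma>) * F (\<lambda>i. v (\<sigma> i)) * \<beta> (\<lambda>i. v (\<sigma> (r + i)))"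
  have \<tau>: "(\<Sum>\<sigma> | \<sigma> permutes {..<r + s}. of_int (sign \<sigma>) * (of_int (sign \<tau>) * F (\<lambda>i. v (\<sigma> (\<tau> i)))) *
      \<beta> (\<lambda>i. v (\<sigma> (r + i)))) = ?R" if "\<tau> permutes {..<r}" for \<tau>
  proof -
    have p: "\<tau> permutes {..<r + s}"
      using that by (rule permutes_subset) auto
    have fin: "permutation \<tau>" using p by (rule permutation_lessThan)
    have "\<tau> (r + i) = r + i" for i
      using that by (simp add: permutes_not_in)
    then have "(\<Sum>\<sigma> | \<sigma> permutes {..<r + s}. of_int (sign \<sigma>) * (of_int (sign \<tau>) * F (\<lambda>i. v (\<sigma> (\<tau> i)))) *
        \<beta> (\<lambda>i. v (\<sigma> (r + i)))) = (\<Sum>\<sigma> | \<sigma> permutes {..<r + s}. ?g (\<sigma> \<circ> \<tau>))"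
      by (intro sum.cong refl)
        (auto simp: sign_compose fin permutation_lessThan)
    also have "\<dots> = ?R"
      by (rule sum_permutes_compose_right[OF p])
    finally show ?thesis .
  qed
  have "wedge r s \<alpha> \<beta> v = c * (\<Sum>\<tau> | \<tau> permutes {..<r}. \<Sum>\<sigma> | \<sigma> permutes {..<r + s}.
      of_int (sign \<sigma>) * (of_int (sign \<tau>) * F (\<lambda>i. v (\<sigma> (\<tau> i)))) * \<beta> (\<lambda>i. v (\<sigma> (r + i)))) / (fact r * fact s)"
    unfolding wedge_def assms
    by (subst sum.swap) (simp add: sum_distrib_left sum_distrib_right mult_ac)
  also have "(\<Sum>\<tau> | \<tau> permutes {..<r}. \<Sum>\<sigma> | \<sigma> permutes {..<r + s}.
      of_int (sign \<sigma>) * (of_int (sign \<tau>) * F (\<lambda>i. v (\<sigma> (\<tau> i)))) * \<beta> (\<lambda>i. v (\<sigma> (r + i)))) =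
      (\<Sum>\<tau> | \<tau> permutes {..<r}. ?R)"
    by (rule sum.cong) (use \<tau> in auto)
  also have "\<dots> = fact r * ?R"
    by (simp add: card_permutations)
  finally show ?thesis by simp
qed

definition shift_perm :: "nat \<Rightarrow> nat \<Rightarrow> (nat \<Rightarrow> nat) \<Rightarrow> nat \<Rightarrow> nat"
  where "shift_perm r s \<tau> = map_permutation {..<s} ((+) r) \<tau>"

lemma shift_perm:
  assumes "\<tau> permutes {..<s}"
  shows "shift_perm r s \<tau> permutes {..<r + s}" "sign (shift_perm r s \<tau>) = sign \<tau>"
    "i < r \<Longrightarrow> shift_perm r s \<tau> i = i" "shift_perm r s \<tau> (r + i) = r + \<tau> i"
proof -
  have im: "(+) r ` {..<s} = {r..<r + s}"
    by (metis add.commute add_0 image_add_atLeastLessThan lessThan_atLeast0)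
  have inj: "inj_on ((+) r) {..<s}" by simp
  have p: "shift_perm r s \<tau> permutes {r..<r + s}"
    unfolding shift_perm_def
    by (rule map_permutation_permutes) (use assms inj im in \<open>auto simp: bij_betw_def\<close>)
  then show "shift_perm r s \<tau> permutes {..<r + s}"
    by (rule permutes_subset) auto
  show "sign (shift_perm r s \<tau>) = sign \<tau>"
    unfolding shift_perm_def by (rule sign_map_permutation) (use assms in auto)
  show "i < r \<Longrightarrow> shift_perm r s \<tau> i = i"
    using p by (simp add: permutes_not_in)
  show "shift_perm r s \<tau> (r + i) = r + \<tau> i"
  proof (cases "i < s")
    case True
    then show ?thesis
      unfolding shift_perm_def by (intro map_permutation_apply) auto
  next
    case False
    then show ?thesis
      using p assms by (simp add: permutes_not_in)
  qed
qed

lemma wedge_alternation_right: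
  assumes \<beta>: "\<And>u. \<beta> u = c * (\<Sum>\<tau> | \<tau> permutes {..<s}. of_int (sign \<tau>) * F (\<lambda>i. u (\<tau> i)))"
    and \<alpha>: "\<And>u u'. (\<And>i. i < r \<Longrightarrow> u i = u' i) \<Longrightarrow> \<alpha> u = \<alpha> u'"
  shows "wedge r s \<alpha> \<beta> v = c / fact r *
    (\<Sum>\<sigma> | \<sigma> permutes {..<r + s}. of_int (sign \<sigma>) * \<alpha> (\<lambda>i. v (\<sigma> i)) * F (\<lambda>i. v (\<sigma> (r + i))))"
    (is "_ = _ * ?R")
proof -
  let ?g = "\<lambda>\<sigma>. of_int (sign \<sigma>) * \<alpha> (\<lambda>i. v (\<sigma> i)) * F (\<lambda>i. v (\<sigma> (r + i)))"
  have \<tau>: "(\<Sum>\<sigma> | \<sigma> permutes {..<r + s}. of_int (sign \<sigma>) * \<alpha> (\<lambda>i. v (\<sigma> i)) *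
      (of_int (sign \<tau>) * F (\<lambda>i. v (\<sigma> (r + \<tau> i))))) = ?R" if "\<tau> permutes {..<s}" for \<tau>
  proof -
    note sp = shift_perm[OF that, where r = r]
    have fin: "permutation (shift_perm r s \<tau>)" using sp(1) by (rule permutation_lessThan)
    have "\<alpha> (\<lambda>i. v (\<sigma> (shift_perm r s \<tau> i))) = \<alpha> (\<lambda>i. v (\<sigma> i))" for \<sigma>
      by (rule \<alpha>) (simp add: sp(3))
    then have "(\<Sum>\<sigma> | \<sigma> permutes {..<r + s}. of_int (sign \<sigma>) * \<alpha> (\<lambda>i. v (\<sigma> i)) *
      (of_int (sign \<tau>) * F (\<lambda>i. v (\<sigma> (r + \<tau> i))))) = (\<Sum>\<sigma> | \<sigma> permutes {..<r + s}. ?g (\<sigma> \<circ> shift_perm r s \<tau>))"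
      by (intro sum.cong refl)
        (auto simp: sp sign_compose fin permutation_lessThan)
    also have "\<dots> = ?R"
      by (rule sum_permutes_compose_right[OF sp(1)])
    finally show ?thesis .
  qed
  have "wedge r s \<alpha> \<beta> v = c * (\<Sum>\<tau> | \<tau> permutes {..<s}. \<Sum>\<sigma> | \<sigma> permutes {..<r + s}.
      of_int (sign \<sigma>) * \<alpha> (\<lambda>i. v (\<sigma> i)) * (of_int (sign \<tau>) * F (\<lambda>i. v (\<sigma> (r + \<tau> i))))) / (fact r * fact s)"
    unfolding wedge_def \<beta>
    by (subst sum.swap) (simp add: sum_distrib_left sum_distrib_right mult_ac)
  also have "(\<Sum>\<tau> | \<tau> permutes {..<s}. \<Sum>\<sigma> | \<sigma> permutes {..<r + s}.
      of_int (sign \<sigma>) * \<alpha> (\<lambda>i. v (\<sigma> i)) * (of_int (sign \<tau>) * F (\<lambda>i. v (\<sigma> (r + \<tau> i))))) =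
      (\<Sum>\<tau> | \<tau> permutes {..<s}. ?R)"
    by (rule sum.cong) (use \<tau> in auto)
  also have "\<dots> = fact s * ?R"
    by (simp add: card_permutations)
  finally show ?thesis by simp
qed

text \<open>Only the factors \<open>1 / fact 2\<close> survive when the inner alternations are absorbed.\<close>

lemma wedge_power_2form:
  "wedge_power 2 (\<lambda>v. \<Omega> (v 0) (v 1)) k v = 1 / 2 ^ k *
    (\<Sum>\<sigma> | \<sigma> permutes {..<2 * k}. of_int (sign \<sigma>) * (\<Prod>i<k. \<Omega> (v (\<sigma> (2 * i))) (v (\<sigma> (2 * i + 1)))))"
proof (induction k arbitrary: v)
  case 0
  show ?case by simp
next
  case (Suc k)
  have "wedge_power 2 (\<lambda>v. \<Omega> (v 0) (v 1)) (Suc k) v = (1 / 2 ^ k) / fact 2 *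
    (\<Sum>\<sigma> | \<sigma> permutes {..<2 + 2 * k}. of_int (sign \<sigma>) * \<Omega> (v (\<sigma> 0)) (v (\<sigma> 1)) *
       (\<Prod>i<k. \<Omega> (v (\<sigma> (2 + 2 * i))) (v (\<sigma> (2 + (2 * i + 1))))))"
    unfolding wedge_power.simps by (rule wedge_alternation_right[OF Suc.IH]) auto
  then show ?case
    by (simp add: prod.lessThan_Suc_shift mult_ac del: prod.lessThan_Suc)
qed

text \<open>The Gram matrix of a symplectic basis that is ordered as
  \<open>e\<^sub>0, f\<^sub>0, e\<^sub>1, f\<^sub>1, \<dots>\<close>.\<close>

definition darboux :: "nat \<Rightarrow> nat \<Rightarrow> real"
  where "darboux a b = (if even a \<and> b = Suc a then 1 else if even b \<and> a = Suc b then -1 else 0)"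

lemma darboux_anti: "darboux b a = - darboux a b"
  by (auto simp: darboux_def)

lemma darboux_blocks:
  "darboux (2 * i) (2 * j) = 0" "darboux (2 * i + 1) (2 * j + 1) = 0"
  "darboux (2 * i) (2 * j + 1) = (if i = j then 1 else 0)"
  "darboux (2 * i + 1) (2 * j) = (if i = j then -1 else 0)"
  by (auto simp: darboux_def) presburger+

text \<open>A permutation with nonzero product maps each pair \<open>{2 i, 2 i + 1}\<close> to such a pair, and
  its sign is \<open>(-1)\<^sup>r\<close> where \<open>r\<close> counts the pairs whose order it reverses; this is also the sign of
  the product. The induction makes the permutation fix the last pair: two simultaneous transpositions
  move the image of that pair into place without changing sign or product, and one transposition
  within the pair changes both signs.\<close>

lemma darboux_sign_nonneg:
  assumes "\<sigma> permutes {..<2 * k}"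
  shows "0 \<le> of_int (sign \<sigma>) * (\<Prod>i<k. darboux (\<sigma> (2 * i)) (\<sigma> (2 * i + 1)))"
  using assms
proof (induction k arbitrary: \<sigma>)
  case 0
  then show ?case by (simp add: sign_nz)
next
  case (Suc k)
  define P where "P \<sigma> = of_int (sign \<sigma>) * (\<Prod>i<Suc k. darboux (\<sigma> (2 * i)) (\<sigma> (2 * i + 1)))"
    for \<sigma> :: "nat \<Rightarrow> nat"
  have fixed: "0 \<le> P \<sigma>"
    if p: "\<sigma> permutes {..<2 * Suc k}" and f: "\<sigma> (2 * k) = 2 * k" "\<sigma> (2 * k + 1) = 2 * k + 1" for \<sigma>
  proof -
    have "\<sigma> permutes {..<2 * k}"
      by (rule permutes_superset[OF p]) (use f in \<open>auto simp: less_Suc_eq\<close>)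
    from Suc.IH[OF this] show ?thesis
      using f by (simp add: P_def darboux_def)
  qed
  have block: "0 \<le> P \<sigma>"
    if p: "\<sigma> permutes {..<2 * Suc k}" and f: "{\<sigma> (2 * k), \<sigma> (2 * k + 1)} = {2 * k, 2 * k + 1}" for \<sigma>
  proof -
    consider "\<sigma> (2 * k) = 2 * k" "\<sigma> (2 * k + 1) = 2 * k + 1" | "\<sigma> (2 * k) = 2 * k + 1" "\<sigma> (2 * k + 1) = 2 * k"
      using f by (auto simp: doubleton_eq_iff)
    then show ?thesis
    proof cases
      case 1
      with fixed p show ?thesis by blast
    next
      case 2
      let ?t = "Transposition.transpose (2 * k) (2 * k + 1)"
      have tp: "?t permutes {..<2 * Suc k}" by (rule permutes_swap_id) auto
      have "0 \<le> P (\<sigma> \<circ> ?t)"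
        by (rule fixed) (use 2 p tp in \<open>auto intro: permutes_compose\<close>)
      moreover have "sign (\<sigma> \<circ> ?t) = - sign \<sigma>"
        using permutation_lessThan[OF p] permutation_lessThan[OF tp] by (simp add: sign_compose sign_swap_id)
      moreover have "(\<Prod>i<k. darboux ((\<sigma> \<circ> ?t) (2 * i)) ((\<sigma> \<circ> ?t) (2 * i + 1))) =
          (\<Prod>i<k. darboux (\<sigma> (2 * i)) (\<sigma> (2 * i + 1)))"
        by (rule prod.cong) (auto simp: transpose_def)
      moreover have "darboux ((\<sigma> \<circ> ?t) (2 * k)) ((\<sigma> \<circ> ?t) (2 * k + 1)) = - darboux (\<sigma> (2 * k)) (\<sigma> (2 * k + 1))"
        by (simp add: darboux_anti[of "\<sigma> (2 * k)"])
      ultimately show ?thesis by (simp add: P_def)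
    qed
  qed
  have "0 \<le> P \<sigma>"
  proof (cases "darboux (\<sigma> (2 * k)) (\<sigma> (2 * k + 1)) = 0")
    case True
    then show ?thesis by (simp add: P_def)
  next
    case False
    then obtain m where m: "{\<sigma> (2 * k), \<sigma> (2 * k + 1)} = {2 * m, 2 * m + 1}"
      by (force simp: darboux_def elim!: evenE split: if_splits)
    have "\<sigma> (2 * k) < 2 * Suc k" "\<sigma> (2 * k + 1) < 2 * Suc k"
      using permutes_in_image[OF Suc.prems] by auto
    with m have "2 * m < 2 * Suc k"
      by (metis insertCI insertE singletonD)
    then have "m \<le> k" by simp
    show ?thesis
    proof (cases "m = k")
      case True
      with m block Suc.prems show ?thesis by blast
    next
      case False
      with \<open>m \<le> k\<close> have "m < k" by simp
      let ?t1 = "Transposition.transpose (2 * m) (2 * k)" and ?t2 = "Transposition.transpose (2 * m + 1) (2 * k + 1)"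
      define \<tau> where "\<tau> = ?t1 \<circ> ?t2"
      have t1: "?t1 permutes {..<2 * Suc k}" and t2: "?t2 permutes {..<2 * Suc k}"
        using \<open>m < k\<close> by (auto intro!: permutes_swap_id)
      have \<tau>: "\<tau> permutes {..<2 * Suc k}"
        unfolding \<tau>_def by (rule permutes_compose[OF t2 t1])
      have "sign \<tau> = 1"
        using permutation_lessThan[OF t1] permutation_lessThan[OF t2] \<open>m < k\<close>
        by (simp add: \<tau>_def sign_compose sign_swap_id)
      then have s: "sign (\<tau> \<circ> \<sigma>) = sign \<sigma>"
        using permutation_lessThan[OF \<tau>] permutation_lessThan[OF Suc.prems] by (simp add: sign_compose)
      have \<tau>_app: "\<tau> (2 * j) = 2 * (Transposition.transpose m k j)"
        "\<tau> (2 * j + 1) = 2 * (Transposition.transpose m k j) + 1" for j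
        by (simp_all add: \<tau>_def Transposition.transpose_def double_not_eq_Suc_double Suc_double_not_eq_double)
      have "darboux (\<tau> a) (\<tau> b) = darboux a b" for a b
      proof -
        obtain i where a: "a = 2 * i \<or> a = 2 * i + 1" by (metis oddE evenE)
        obtain j where b: "b = 2 * j \<or> b = 2 * j + 1" by (metis oddE evenE)
        have "Transposition.transpose m k i = Transposition.transpose m k j \<longleftrightarrow> i = j"
          by (auto dest: Transposition.transpose_eq_imp_eq)
        then show ?thesis
          using a b by (elim disjE) (simp_all only: \<tau>_app darboux_blocks)
      qed
      then have "P (\<tau> \<circ> \<sigma>) = P \<sigma>" by (simp add: P_def s)
      moreover have "{(\<tau> \<circ> \<sigma>) (2 * k), (\<tau> \<circ> \<sigma>) (2 * k + 1)} = \<tau> ` {\<sigma> (2 * k), \<sigma> (2 * k + 1)}"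
        by simp
      then have "{(\<tau> \<circ> \<sigma>) (2 * k), (\<tau> \<circ> \<sigma>) (2 * k + 1)} = {2 * k, 2 * k + 1}"
        unfolding m using \<tau>_app[of m] by simp
      then have "0 \<le> P (\<tau> \<circ> \<sigma>)"
        using Suc.prems \<tau> by (intro block permutes_compose)
      ultimately show ?thesis by simp
    qed
  qed
  then show ?case by (simp add: P_def)
qed

text \<open>Since \<open>\<eta>\<close> vanishes on all but the last vector, only permutations fixing the last index
  contribute. The remaining terms are nonnegative multiples of \<open>\<eta> (v (2 * k))\<close>, and the identity
  contributes a positive multiple.\<close>

lemma contact_form_nonzero:
  fixes v :: "nat \<Rightarrow> 'a" and \<Omega> :: "'a \<Rightarrow> 'a \<Rightarrow> real" and \<eta> :: "'a \<Rightarrow> real"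
  assumes \<Omega>: "\<And>a b. a < 2 * k \<Longrightarrow> b < 2 * k \<Longrightarrow> \<Omega> (v a) (v b) = darboux a b"
    and \<eta>: "\<And>a. a < 2 * k \<Longrightarrow> \<eta> (v a) = 0" "\<eta> (v (2 * k)) \<noteq> 0"
  shows "wedge (2 * k) 1 (wedge_power 2 (\<lambda>v. \<Omega> (v 0) (v 1)) k) (\<lambda>v. \<eta> (v 0)) v \<noteq> 0"
proof -
  let ?D = "\<lambda>\<sigma>. of_int (sign \<sigma>) * (\<Prod>i<k. darboux (\<sigma> (2 * i)) (\<sigma> (2 * i + 1)))"
  let ?f = "\<lambda>\<sigma>. of_int (sign \<sigma>) * (\<Prod>i<k. \<Omega> (v (\<sigma> (2 * i))) (v (\<sigma> (2 * i + 1)))) * \<eta> (v (\<sigma> (2 * k)))"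
  have "wedge (2 * k) 1 (wedge_power 2 (\<lambda>v. \<Omega> (v 0) (v 1)) k) (\<lambda>v. \<eta> (v 0)) v =
      (1 / 2 ^ k) / fact 1 * (\<Sum>\<sigma> | \<sigma> permutes {..<2 * k + 1}. of_int (sign \<sigma>) *
        (\<Prod>i<k. \<Omega> (v (\<sigma> (2 * i))) (v (\<sigma> (2 * i + 1)))) * \<eta> (v (\<sigma> (2 * k + 0))))"
    by (rule wedge_alternation_left[OF wedge_power_2form])
  also have "(\<Sum>\<sigma> | \<sigma> permutes {..<2 * k + 1}. of_int (sign \<sigma>) *
        (\<Prod>i<k. \<Omega> (v (\<sigma> (2 * i))) (v (\<sigma> (2 * i + 1)))) * \<eta> (v (\<sigma> (2 * k + 0)))) =
      (\<Sum>\<sigma> | \<sigma> permutes {..<2 * k + 1}. ?f \<sigma>)"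
    by simp
  also have "\<dots> = (\<Sum>\<sigma> | \<sigma> permutes {..<2 * k}. ?f \<sigma>)"
  proof (rule sum.mono_neutral_right)
    show "finite {\<sigma>. \<sigma> permutes {..<2 * k + 1}}" by (simp add: finite_permutations)
    show "{\<sigma>. \<sigma> permutes {..<2 * k}} \<subseteq> {\<sigma>. \<sigma> permutes {..<2 * k + 1}}"
      by (auto intro: permutes_subset)
    show "\<forall>\<sigma> \<in> {\<sigma>. \<sigma> permutes {..<2 * k + 1}} - {\<sigma>. \<sigma> permutes {..<2 * k}}. ?f \<sigma> = 0"
    proof
      fix \<sigma> assume s: "\<sigma> \<in> {\<sigma>. \<sigma> permutes {..<2 * k + 1}} - {\<sigma>. \<sigma> permutes {..<2 * k}}"
      then have "\<sigma> (2 * k) \<noteq> 2 * k"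
        using permutes_superset[of \<sigma> "{..<2 * k + 1}" "{..<2 * k}"] by (auto simp: less_Suc_eq)
      moreover have "\<sigma> (2 * k) < 2 * k + 1"
        using s permutes_in_image[of \<sigma> "{..<2 * k + 1}" "2 * k"] by auto
      ultimately show "?f \<sigma> = 0" using \<eta>(1) by simp
    qed
  qed
  also have "\<dots> = (\<Sum>\<sigma> | \<sigma> permutes {..<2 * k}. ?D \<sigma>) * \<eta> (v (2 * k))"
    unfolding sum_distrib_right
  proof (rule sum.cong[OF refl])
    fix \<sigma> assume "\<sigma> \<in> {\<sigma>. \<sigma> permutes {..<2 * k}}"
    then have s: "\<sigma> permutes {..<2 * k}" by simp
    have "\<sigma> a < 2 * k" if "a < 2 * k" for a
      using permutes_in_image[OF s] that by auto
    moreover have "\<sigma> (2 * k) = 2 * k" using s by (simp add: permutes_not_in)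
    ultimately show "?f \<sigma> = ?D \<sigma> * \<eta> (v (2 * k))"
      by (simp add: \<Omega>)
  qed
  finally have eq: "wedge (2 * k) 1 (wedge_power 2 (\<lambda>v. \<Omega> (v 0) (v 1)) k) (\<lambda>v. \<eta> (v 0)) v =
      (1 / 2 ^ k) / fact 1 * ((\<Sum>\<sigma> | \<sigma> permutes {..<2 * k}. ?D \<sigma>) * \<eta> (v (2 * k)))" .
  have "1 = ?D id" by (simp add: darboux_def)
  also have "\<dots> \<le> (\<Sum>\<sigma> | \<sigma> permutes {..<2 * k}. ?D \<sigma>)"
    using darboux_sign_nonneg by (intro member_le_sum) (auto simp: finite_permutations permutes_id[unfolded id_def])
  finally show ?thesis unfolding eq using \<eta>(2) by simp
qed

section \<open>Symplectic bases\<close>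

text \<open>Split off a hyperbolic plane spanned by \<open>e\<close> and \<open>f\<close> with \<open>\<Omega> e f = 1\<close>, and continue
  in its \<open>\<Omega>\<close>-orthogonal complement, on which \<open>\<Omega>\<close> is again nondegenerate.\<close>

lemma symplectic_basis_exists:
  fixes V :: "'a::euclidean_space set"
  assumes "bilinear \<Omega>" "\<And>x. \<Omega> x x = 0" "subspace V"
    and "\<And>x. x \<in> V \<Longrightarrow> x \<noteq> 0 \<Longrightarrow> \<exists>y\<in>V. \<Omega> x y \<noteq> 0"
  shows "\<exists>k v. dim V = 2 * k \<and> (\<forall>a<2 * k. v a \<in> V) \<and>
    (\<forall>a<2 * k. \<forall>b<2 * k. \<Omega> (v a) (v b) = darboux a b)"
  using assms(3,4)
proof (induction "dim V" arbitrary: V rule: less_induct)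
  case (less V)
  note bl = bilinear_ladd[OF assms(1)] bilinear_radd[OF assms(1)] bilinear_lmul[OF assms(1)]
    bilinear_rmul[OF assms(1)] bilinear_lsub[OF assms(1)] bilinear_rsub[OF assms(1)]
    bilinear_lzero[OF assms(1)] bilinear_rzero[OF assms(1)]
  have anti: "\<Omega> y x = - \<Omega> x y" for x y
  proof -
    have "\<Omega> (x + y) (x + y) = \<Omega> x x + \<Omega> x y + \<Omega> y x + \<Omega> y y"
      by (simp add: bl)
    then show ?thesis by (simp add: assms(2))
  qed
  show ?case
  proof (cases "V \<subseteq> {0}")
    case True
    then have "dim V = 0" by simp
    then show ?thesis by (intro exI[of _ 0]) simp
  next
    case False
    then obtain e f' where e: "e \<in> V" "f' \<in> V" "\<Omega> e f' \<noteq> 0"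
      using less.prems(2) by blast
    define f where "f = f' /\<^sub>R \<Omega> e f'"
    have f: "f \<in> V" "\<Omega> e f = 1"
      using e less.prems(1) by (auto simp: f_def bl subspace_scale)
    then have fe: "\<Omega> f e = -1" by (simp add: anti[of f e])
    define W where "W = {x \<in> V. \<Omega> x e = 0 \<and> \<Omega> x f = 0}"
    have W: "subspace W"
      using less.prems(1) by (auto simp: subspace_def W_def bl)
    \<comment> \<open>The projection onto the complement \<open>W\<close> along the plane.\<close>
    define p where "p x = x + \<Omega> x e *\<^sub>R f - \<Omega> x f *\<^sub>R e" for x
    have pW: "p x \<in> W" if "x \<in> V" for x
      using that e f less.prems(1)
      by (auto simp: W_def p_def bl assms(2) fe intro!: subspace_add subspace_diff subspace_scale)
    have spanV: "span {e, f} \<subseteq> V"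
      by (rule span_minimal) (use e f less.prems(1) in auto)
    have ind: "independent {e, f}" "e \<noteq> f"
    proof -
      show "e \<noteq> f" using f assms(2) by force
      have "e \<notin> span {f}"
        using fe by (auto simp: span_singleton bl assms(2))
      moreover have "f \<noteq> 0" using f by (auto simp: bl)
      ultimately show "independent {e, f}"
        using \<open>e \<noteq> f\<close> by (simp add: independent_insert)
    qed
    then have d2: "dim {e, f} = 2"
      by (simp add: dim_eq_card_independent)
    have int: "span {e, f} \<inter> W = {0}"
    proof -
      have "x = 0" if "x \<in> span {e, f}" "x \<in> W" for x
      proof -
        obtain s t where x: "x = s *\<^sub>R e + t *\<^sub>R f"
          using \<open>x \<in> span {e, f}\<close> by (auto simp: span_insert span_singleton algebra_simps)
        with that(2) f fe show "x = 0" by (auto simp: W_def bl assms(2))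
      qed
      then show ?thesis using subspace_0[OF W] span_0 by auto
    qed
    have sum: "{x + y |x y. x \<in> span {e, f} \<and> y \<in> W} = V" (is "?S = V")
    proof
      show "?S \<subseteq> V"
        using spanV less.prems(1) by (auto simp: W_def intro!: subspace_add)
      show "V \<subseteq> ?S"
      proof
        fix x assume "x \<in> V"
        have "x = (\<Omega> x f *\<^sub>R e - \<Omega> x e *\<^sub>R f) + p x" by (simp add: p_def)
        moreover have "\<Omega> x f *\<^sub>R e - \<Omega> x e *\<^sub>R f \<in> span {e, f}"
          by (intro span_diff span_scale) (auto intro: span_base)
        ultimately show "x \<in> ?S" using pW[OF \<open>x \<in> V\<close>] by blast
      qed
    qed
    have dim: "dim V = dim W + 2"
      using dim_sums_Int[OF subspace_span[of "{e, f}"] W] by (simp add: sum int d2)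
    have nd: "\<exists>y\<in>W. \<Omega> x y \<noteq> 0" if x: "x \<in> W" "x \<noteq> 0" for x
    proof -
      obtain y where y: "y \<in> V" "\<Omega> x y \<noteq> 0"
        using less.prems(2) x by (auto simp: W_def)
      have "\<Omega> x (p y) = \<Omega> x y"
        using x by (simp add: p_def bl W_def)
      with y pW show ?thesis by metis
    qed
    obtain k u where u: "dim W = 2 * k" "\<forall>a<2 * k. u a \<in> W"
      "\<forall>a<2 * k. \<forall>b<2 * k. \<Omega> (u a) (u b) = darboux a b"
      using less.hyps[OF _ W nd] dim by auto
    define v where "v a = (if a < 2 * k then u a else if a = 2 * k then e else f)" for a
    have ez: "\<Omega> (u a) e = 0" "\<Omega> (u a) f = 0" "\<Omega> e (u a) = 0" "\<Omega> f (u a) = 0" if "a < 2 * k" for a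
      using u(2) that anti[of "u a"] by (auto simp: W_def)
    have "\<Omega> (v a) (v b) = darboux a b" if ab: "a < 2 * Suc k" "b < 2 * Suc k" for a b
    proof -
      have small: "a < 2 * k \<or> a = 2 * k \<or> a = Suc (2 * k)" "b < 2 * k \<or> b = 2 * k \<or> b = Suc (2 * k)"
        using ab by auto
      have "darboux a b = 0" "darboux b a = 0" if "a < 2 * k" "b = 2 * k \<or> b = Suc (2 * k)" for a b
        using that by (auto simp: darboux_def double_not_eq_Suc_double elim!: evenE)
      with small show ?thesis
        using u(3) ez f fe assms(2) by (auto simp: v_def) (auto simp: darboux_def)
    qed
    moreover have "v a \<in> V" if "a < 2 * Suc k" for a
      using u(2) e f by (auto simp: v_def W_def)
    ultimately show ?thesis
      using dim u(1) by (intro exI[of _ "Suc k"] exI[of _ v]) simp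
  qed
qed

section \<open>A contact functional on the Lie algebra\<close>

text \<open>The differential of left translation by \<open>(b, A)\<close> is \<open>lmul A\<close> at every point.\<close>

definition lmul :: "real ^ 'n ^ 'n \<Rightarrow> (real ^ 'n) \<times> (real ^ 'n ^ 'n) \<Rightarrow> (real ^ 'n) \<times> (real ^ 'n ^ 'n)"
  where "lmul A x = (A *v fst x, A ** snd x)"

lemma lmul_mult: "lmul A (lmul B x) = lmul (A ** B) x"
  by (simp add: lmul_def matrix_vector_mul_assoc matrix_mul_assoc)

lemma lmul_one: "lmul (mat 1) x = x"
  by (simp add: lmul_def)

lemma lmul_bilinear: "bilinear lmul"
  unfolding bilinear_def
  by (intro conjI allI linearI)
    (simp_all add: lmul_def prod_eq_iff vec_eq_iff matrix_vector_mult_def matrix_matrix_mult_def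
      sum_distrib_left sum.distrib ring_distribs mult_ac)

lemma bounded_bilinear_lmul: "bounded_bilinear lmul"
  using lmul_bilinear by (simp add: bilinear_conv_bounded_bilinear)

text \<open>The vector representing the functional
  \<open>(b, A) \<mapsto> (\<Sum>i. b\<^sub>i) + (\<Sum>i. m\<^sub>i A\<^sub>i\<^sub>i)\<close> through the inner product.\<close>

definition contact_covector :: "('n \<Rightarrow> real) \<Rightarrow> (real ^ 'n) \<times> (real ^ 'n ^ 'n)"
  where "contact_covector m = ((\<chi> i. 1), (\<chi> i j. if i = j then m i else 0))"

text \<open>The Lie algebra of the special affine group, as the tangent space at the identity.\<close>

definition traceless :: "((real ^ 'n) \<times> (real ^ 'n ^ 'n)) set"
  where "traceless = {x. trace (snd x) = 0}"

text \<open>The value of the functional on the Lie bracket of \<open>y\<close> and \<open>x\<close>, in this order; on the Lie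
  algebra it is the exterior derivative of the functional.\<close>

definition bracket_form ::
  "('n \<Rightarrow> real) \<Rightarrow> (real ^ 'n) \<times> (real ^ 'n ^ 'n) \<Rightarrow> (real ^ 'n) \<times> (real ^ 'n ^ 'n) \<Rightarrow> real"
  where "bracket_form m x y = (lmul (snd y) x - lmul (snd x) y) \<bullet> contact_covector m"

text \<open>For injective \<open>m\<close>, the vector spanning the radical of \<open>bracket_form m\<close> on \<open>traceless\<close>; a multiple of it
  is the Reeb vector of the contact form. Its diagonal entries make the column sums vanish.\<close>

definition reeb :: "('n::finite \<Rightarrow> real) \<Rightarrow> (real ^ 'n) \<times> (real ^ 'n ^ 'n)"
  where "reeb m = ((\<chi> i. 1), (\<chi> i j. if i = j then - (\<Sum>k\<in>UNIV - {i}. 1 / (m k - m i)) else 1 / (m i - m j)))"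

lemma inner_contact_covector: "x \<bullet> contact_covector m = (\<Sum>i\<in>UNIV. fst x $ i) + (\<Sum>i\<in>UNIV. m i * snd x $ i $ i)"
proof -
  have "(\<Sum>j\<in>UNIV. snd x $ i $ j * (if i = j then m i else 0)) = m i * snd x $ i $ i" for i
    by (simp add: if_distrib mult.commute sum.delta cong: if_cong)
  then show ?thesis
    by (simp add: contact_covector_def inner_prod_def inner_vec_def)
qed

text \<open>Arranged by the coordinates of the second argument, so that pairing with a matrix unit or
  a translation reads off a single equation for \<open>(b, A)\<close>.\<close>

lemma bracket_form_eq:
  "bracket_form m (b, A) (c, B) =
    (\<Sum>i\<in>UNIV. \<Sum>j\<in>UNIV. B $ i $ j * (b $ j + (m i - m j) * A $ j $ i)) - (\<Sum>j\<in>UNIV. (\<Sum>i\<in>UNIV. A $ i $ j) * c $ j)"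
proof -
  have 1: "(\<Sum>i\<in>UNIV. m i * (\<Sum>j\<in>UNIV. A $ i $ j * B $ j $ i)) = (\<Sum>i\<in>UNIV. \<Sum>j\<in>UNIV. B $ i $ j * m j * A $ j $ i)"
    by (subst sum.swap) (simp add: sum_distrib_left mult_ac)
  have 2: "(\<Sum>i\<in>UNIV. \<Sum>j\<in>UNIV. A $ i $ j * c $ j) = (\<Sum>j\<in>UNIV. (\<Sum>i\<in>UNIV. A $ i $ j) * c $ j)"
    by (subst sum.swap) (simp add: sum_distrib_right)
  have 3: "(\<Sum>i\<in>UNIV. \<Sum>j\<in>UNIV. B $ i $ j * (b $ j + (m i - m j) * A $ j $ i)) =
      (\<Sum>i\<in>UNIV. \<Sum>j\<in>UNIV. B $ i $ j * b $ j) + (\<Sum>i\<in>UNIV. m i * (\<Sum>j\<in>UNIV. B $ i $ j * A $ j $ i)) -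
      (\<Sum>i\<in>UNIV. \<Sum>j\<in>UNIV. B $ i $ j * m j * A $ j $ i)"
    by (simp add: sum_distrib_left flip: sum.distrib sum_subtractf) (simp add: algebra_simps)
  show ?thesis
    unfolding bracket_form_def inner_diff_left inner_contact_covector 3
    by (simp add: lmul_def matrix_vector_mult_def matrix_matrix_mult_def sum_subtractf
        right_diff_distrib 1 2)
qed

text \<open>The terms of the double sum are antisymmetric in the two indices.\<close>

lemma reeb_traceless: "reeb m \<in> traceless"
proof -
  let ?t = "\<lambda>i k. if k = i then 0 else 1 / (m k - m i)"
  have "(\<Sum>i\<in>UNIV. \<Sum>k\<in>UNIV - {i}. 1 / (m k - m i)) = (\<Sum>i\<in>UNIV. \<Sum>k\<in>UNIV. ?t i k)"
    by (intro sum.cong refl sum.mono_neutral_cong_left) auto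
  moreover have "(\<Sum>i\<in>UNIV. \<Sum>k\<in>UNIV. ?t i k) = - (\<Sum>i\<in>UNIV. \<Sum>k\<in>UNIV. ?t i k)"
  proof -
    have "(\<Sum>i\<in>UNIV. \<Sum>k\<in>UNIV. ?t i k) = (\<Sum>i\<in>UNIV. \<Sum>k\<in>UNIV. ?t k i)" by (rule sum.swap)
    also have "\<dots> = (\<Sum>i\<in>UNIV. \<Sum>k\<in>UNIV. - ?t i k)"
      by (intro sum.cong refl) (auto simp: minus_divide_right simp del: divide_minus_left)
    finally show ?thesis by (simp add: sum_negf)
  qed
  ultimately show ?thesis
    by (simp add: traceless_def trace_def reeb_def sum_negf)
qed

lemma reeb_radical:
  assumes "inj m" "y \<in> traceless"
  shows "bracket_form m (reeb m) y = 0"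
proof -
  obtain c B where y: "y = (c, B)" by force
  have col: "(\<Sum>i\<in>UNIV. snd (reeb m) $ i $ j) = 0" for j
    by (subst sum.remove[of _ j]) (auto simp: reeb_def intro!: sum.cong)
  have "B $ i $ j * (fst (reeb m) $ j + (m i - m j) * snd (reeb m) $ j $ i) = (if i = j then B $ i $ i else 0)" for i j
  proof (cases "i = j")
    case False
    then have "m j - m i \<noteq> 0" using assms(1) by (auto dest: injD)
    then show ?thesis using False by (simp add: reeb_def field_simps)
  qed (simp add: reeb_def)
  then have "(\<Sum>i\<in>UNIV. \<Sum>j\<in>UNIV. B $ i $ j * (fst (reeb m) $ j + (m i - m j) * snd (reeb m) $ j $ i)) = trace B"
    by (simp add: trace_def)
  then show ?thesis
    using bracket_form_eq[of m "fst (reeb m)" "snd (reeb m)" c B] assms(2) col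
    by (simp add: y traceless_def)
qed

text \<open>For each of the \<open>n (n - 1) / 2\<close> unordered pairs of indices, the two corresponding terms
  of the double sum add up to \<open>-1\<close>. The double sum is subtracted from \<open>n\<close>.\<close>

lemma inner_reeb_covector_pos:
  fixes m :: "'n::finite \<Rightarrow> real"
  assumes "inj m"
  shows "reeb m \<bullet> contact_covector m > 0"
proof -
  let ?t = "\<lambda>i k. if k = i then 0 else m i / (m k - m i)"
  have "m i * (\<Sum>k\<in>UNIV - {i}. 1 / (m k - m i)) = (\<Sum>k\<in>UNIV. ?t i k)" for i
    unfolding sum_distrib_left by (intro sum.mono_neutral_cong_left) auto
  then have eq: "reeb m \<bullet> contact_covector m = real CARD('n) - (\<Sum>i\<in>UNIV. \<Sum>k\<in>UNIV. ?t i k)"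
    by (simp add: inner_contact_covector reeb_def sum_negf)
  have "2 * (\<Sum>i\<in>UNIV. \<Sum>k\<in>UNIV. ?t i k) = (\<Sum>i\<in>UNIV. \<Sum>k\<in>UNIV. ?t i k) + (\<Sum>i\<in>UNIV. \<Sum>k\<in>UNIV. ?t k i)"
    by (subst (3) sum.swap) simp
  also have "\<dots> = (\<Sum>i\<in>UNIV. \<Sum>k\<in>UNIV. ?t i k + ?t k i)"
    by (simp add: sum.distrib)
  also have "\<dots> \<le> 0"
  proof (intro sum_nonpos)
    fix i k
    show "?t i k + ?t k i \<le> 0"
    proof (cases "i = k")
      case False
      then have "m k - m i \<noteq> 0" using assms by (auto dest: injD)
      then have "m i / (m k - m i) + m k / (m i - m k) = -1"
        by (simp add: divide_simps) (simp add: algebra_simps)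
      then show ?thesis using False by simp
    qed simp
  qed
  finally have "(\<Sum>i\<in>UNIV. \<Sum>k\<in>UNIV. ?t i k) \<le> 0" by simp
  moreover have "0 < real CARD('n)" by simp
  ultimately show ?thesis unfolding eq by linarith
qed

text \<open>Test vectors are the translations, the off-diagonal matrix units, and the differences of
  diagonal matrix units.\<close>

lemma bracket_form_radical:
  fixes m :: "'n::finite \<Rightarrow> real"
  assumes "inj m" and rad: "\<And>y. y \<in> traceless \<Longrightarrow> bracket_form m x y = 0"
  shows "\<exists>s. x = s *\<^sub>R reeb m"
proof -
  obtain b A where x: "x = (b, A)" by force
  have col: "(\<Sum>i\<in>UNIV. A $ i $ j) = 0" for j
  proof -
    have "(axis j 1, 0) \<in> traceless" by (simp add: traceless_def trace_def)
    from rad[OF this] show ?thesis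
      by (simp add: x bracket_form_eq axis_def if_distrib sum.delta cong: if_cong)
  qed
  have unit: "bracket_form m x (0, axis i (axis j 1)) = b $ j + (m i - m j) * A $ j $ i" for i j
  proof -
    have "(\<Sum>i'\<in>UNIV. \<Sum>j'\<in>UNIV. (axis i (axis j 1) :: real ^ 'n ^ 'n) $ i' $ j' * (b $ j' + (m i' - m j') * A $ j' $ i'))
      = (\<Sum>i'\<in>UNIV. if i' = i then \<Sum>j'\<in>UNIV. (if j' = j then b $ j + (m i - m j) * A $ j $ i else 0) else 0)"
      by (intro sum.cong refl) (auto simp: axis_def simp del: sum.delta sum.delta' intro!: sum.cong)
    then show ?thesis by (simp add: x bracket_form_eq)
  qed
  have off: "b $ j + (m i - m j) * A $ j $ i = 0" if "i \<noteq> j" for i j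
    unfolding unit[symmetric]
    by (rule rad) (use that in \<open>auto simp: traceless_def trace_def axis_def intro!: sum.neutral\<close>)
  have diag: "b $ i = b $ j" for i j
  proof -
    have "(0, axis i (axis i 1) - axis j (axis j 1) :: real ^ 'n ^ 'n) \<in> traceless"
      by (simp add: traceless_def trace_def sum_subtractf axis_def if_distrib[of "\<lambda>x. x $ _"] cong: if_cong)
    from rad[OF this] have "bracket_form m x (0, axis i (axis i 1)) - bracket_form m x (0, axis j (axis j 1)) = 0"
      by (simp add: x bracket_form_eq left_diff_distrib sum_subtractf)
    then show ?thesis by (simp add: unit)
  qed
  define s where "s = b $ undefined"
  have b: "b $ j = s" for j unfolding s_def by (rule diag)
  have Aoff: "A $ j $ i = s / (m j - m i)" if "i \<noteq> j" for i j
  proof -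
    have "m j - m i \<noteq> 0" using assms(1) that by (auto dest: injD)
    then show ?thesis using off[OF that] by (simp add: b field_simps)
  qed
  have Adiag: "A $ i $ i = - (\<Sum>k\<in>UNIV - {i}. s / (m k - m i))" for i
  proof -
    have "0 = A $ i $ i + (\<Sum>k\<in>UNIV - {i}. A $ k $ i)"
      using col[of i] by (subst (asm) sum.remove[of _ i]) auto
    also have "(\<Sum>k\<in>UNIV - {i}. A $ k $ i) = (\<Sum>k\<in>UNIV - {i}. s / (m k - m i))"
      by (intro sum.cong refl Aoff) auto
    finally show ?thesis by simp
  qed
  have "x = s *\<^sub>R reeb m"
    by (auto simp: x reeb_def prod_eq_iff vec_eq_iff b Aoff Adiag sum_distrib_left)
  then show ?thesis ..
qed

lemma bilinear_bracket_form: "bilinear (bracket_form m)"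
  unfolding bilinear_def bracket_form_def
  by (intro conjI allI linearI)
    (simp_all add: bilinear_ladd[OF lmul_bilinear] bilinear_radd[OF lmul_bilinear]
      bilinear_lmul[OF lmul_bilinear] bilinear_rmul[OF lmul_bilinear]
      inner_add_left inner_diff_left algebra_simps)

lemma bracket_form_self: "bracket_form m x x = 0"
  by (simp add: bracket_form_def)

section \<open>The special affine group as a Lie group\<close>

lemma carrier_special_affine_group:
  "x \<in> carrier special_affine_group \<longleftrightarrow> det (snd x) = 1"
  by (cases x) (simp add: special_affine_group_def)

lemma mult_special_affine_group:
  "x \<otimes>\<^bsub>special_affine_group\<^esub> y = (fst x, 0) + lmul (snd x) y"
  by (simp add: special_affine_group_def lmul_def case_prod_unfold)

lemma one_special_affine_group: "\<one>\<^bsub>special_affine_group\<^esub> = (0, mat 1)"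
  by (simp add: special_affine_group_def)

definition affine_inverse :: "(real ^ 'n) \<times> (real ^ 'n ^ 'n) \<Rightarrow> (real ^ 'n) \<times> (real ^ 'n ^ 'n)"
  where "affine_inverse x = (- (matrix_inv (snd x) *v fst x), matrix_inv (snd x))"

lemma affine_inverse:
  assumes "x \<in> carrier special_affine_group"
  shows "affine_inverse x \<in> carrier special_affine_group"
    "affine_inverse x \<otimes>\<^bsub>special_affine_group\<^esub> x = \<one>\<^bsub>special_affine_group\<^esub>"
proof -
  have d: "det (snd x) = 1" using assms by (simp add: carrier_special_affine_group)
  have "det (snd x) * det (matrix_inv (snd x)) = 1"
    using det_mul[of "snd x" "matrix_inv (snd x)"] d by (simp add: matrix_inv_cancel)
  then show "affine_inverse x \<in> carrier special_affine_group"
    by (simp add: d affine_inverse_def carrier_special_affine_group)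
  show "affine_inverse x \<otimes>\<^bsub>special_affine_group\<^esub> x = \<one>\<^bsub>special_affine_group\<^esub>"
    by (simp add: d affine_inverse_def mult_special_affine_group one_special_affine_group lmul_def matrix_inv_cancel)
qed

lemma group_special_affine_group: "group (special_affine_group :: ((real ^ 'n) \<times> (real ^ 'n ^ 'n)) monoid)"
  (is "group ?G")
proof (rule groupI)
  show "\<one>\<^bsub>?G\<^esub> \<in> carrier ?G"
    by (simp add: carrier_special_affine_group one_special_affine_group)
next
  fix x y assume "x \<in> carrier ?G" "y \<in> carrier ?G"
  then show "x \<otimes>\<^bsub>?G\<^esub> y \<in> carrier ?G"
    by (simp add: carrier_special_affine_group mult_special_affine_group lmul_def det_mul)
next
  fix x y z
  show "(x \<otimes>\<^bsub>?G\<^esub> y) \<otimes>\<^bsub>?G\<^esub> z = x \<otimes>\<^bsub>?G\<^esub> (y \<otimes>\<^bsub>?G\<^esub> z)"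
    by (rule injD[OF inj_affine_motion]) (simp add: affine_motion_mult comp_assoc)
next
  fix x show "\<one>\<^bsub>?G\<^esub> \<otimes>\<^bsub>?G\<^esub> x = x"
    by (rule injD[OF inj_affine_motion]) (simp add: affine_motion_mult affine_motion_one)
next
  fix x assume "x \<in> carrier ?G"
  then show "\<exists>y\<in>carrier ?G. y \<otimes>\<^bsub>?G\<^esub> x = \<one>\<^bsub>?G\<^esub>"
    using affine_inverse by blast
qed

lemma inv_special_affine_group:
  assumes "x \<in> carrier special_affine_group"
  shows "inv\<^bsub>special_affine_group\<^esub> x = affine_inverse x"
  using affine_inverse[OF assms] assms by (intro group.inv_equality[OF group_special_affine_group])

definition row_replace :: "'n \<Rightarrow> real ^ 'n ^ 'n \<Rightarrow> real ^ 'n \<Rightarrow> real ^ 'n ^ 'n"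
  where "row_replace i A r = (\<chi> k. if k = i then r else A $ k)"

lemma linear_det_row_replace:
  fixes A :: "real ^ 'n ^ 'n"
  shows "linear (\<lambda>r. det (row_replace i A r))"
proof (rule linearI)
  fix r s :: "real ^ 'n" and c :: real
  show "det (row_replace i A (r + s)) = det (row_replace i A r) + det (row_replace i A s)"
    unfolding row_replace_def by (rule det_row_add)
  show "det (row_replace i A (c *\<^sub>R r)) = c *\<^sub>R det (row_replace i A r)"
    unfolding row_replace_def scalar_mult_eq_scaleR[symmetric] real_scaleR_def by (rule det_row_mul)
qed

lemma row_replace_same: "row_replace i A (A $ i) = A"
  by (simp add: row_replace_def vec_eq_iff)

abbreviation cofactor :: "'n \<Rightarrow> 'n \<Rightarrow> real ^ 'n ^ 'n \<Rightarrow> real"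
  where "cofactor i j A \<equiv> det (row_replace i A (axis j 1))"

text \<open>Expansion of the determinant along row \<open>i\<close>.\<close>

lemma exists_cofactor_nonzero:
  fixes A :: "real ^ 'n ^ 'n"
  assumes "det A \<noteq> 0"
  shows "\<exists>j. cofactor i j A \<noteq> 0"
proof (rule ccontr)
  assume "\<not> ?thesis"
  then have z: "cofactor i j A = 0" for j by blast
  have "det A = det (row_replace i A (\<Sum>j\<in>UNIV. A $ i $ j *\<^sub>R axis j 1))"
    using basis_expansion[of "A $ i"] by (simp add: row_replace_same scalar_mult_eq_scaleR)
  also have "\<dots> = (\<Sum>j\<in>UNIV. A $ i $ j * cofactor i j A)"
    by (simp add: linear_sum[OF linear_det_row_replace] linear_scale[OF linear_det_row_replace])
  finally show False using z assms by simp
qed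

lemma det_add_entry:
  "det (A + t *\<^sub>R axis i (axis j 1)) = det A + t * cofactor i j A"
proof -
  have "A + t *\<^sub>R axis i (axis j 1) = row_replace i A (A $ i + t *\<^sub>R axis j 1)"
    by (auto simp: row_replace_def vec_eq_iff axis_def)
  then show ?thesis
    by (simp add: linear_add[OF linear_det_row_replace] linear_scale[OF linear_det_row_replace]
        row_replace_same)
qed

lemma cofactor_add_entry: "cofactor i j (A + t *\<^sub>R axis i (axis j 1)) = cofactor i j A"
  by (rule arg_cong[of _ _ det]) (auto simp: row_replace_def vec_eq_iff axis_def)

lemma Cinf_on_cofactor:
  assumes "open S" "Cinf_on S A"
  shows "Cinf_on S (\<lambda>x. cofactor i j (A x))"
proof (intro Cinf_on_det Cinf_on_vec \<open>open S\<close>)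
  fix k l show "Cinf_on S (\<lambda>x. row_replace i (A x) (axis j 1) $ k $ l)"
    using assms by (cases "k = i") (auto simp: row_replace_def intro!: Cinf_on_const Cinf_on_nth)
qed

text \<open>Near a point where the cofactor of the entry \<open>(i, j)\<close> is nonzero, the chart replaces that
  entry by \<open>det A - 1\<close>. Changing the entry does not affect its cofactor, and \<open>det\<close> is an affine
  function of the entry with the cofactor as slope, so the chart is inverted by solving a linear
  equation. It maps the group into the hyperplane where the entry is zero.\<close>

lemma embedded_submanifold_special_affine_group:
  "embedded_submanifold (DIM((real ^ 'n) \<times> (real ^ 'n ^ 'n)) - 1)
    (carrier (special_affine_group :: ((real ^ 'n) \<times> (real ^ 'n ^ 'n)) monoid))"
  (is "embedded_submanifold ?d ?M")
  unfolding embedded_submanifold_def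
proof
  fix p assume "p \<in> ?M"
  then have "det (snd p) \<noteq> 0" by (simp add: carrier_special_affine_group)
  then obtain i j :: 'n where ij: "cofactor i j (snd p) \<noteq> 0"
    using exists_cofactor_nonzero by blast
  define e :: "(real ^ 'n) \<times> (real ^ 'n ^ 'n)" where "e = (0, axis i (axis j 1))"
  define U where "U = {x :: (real ^ 'n) \<times> (real ^ 'n ^ 'n). cofactor i j (snd x) \<noteq> 0}"
  define \<phi> where "\<phi> x = x + (det (snd x) - 1 - snd x $ i $ j) *\<^sub>R e" for x
  define \<psi> where "\<psi> y = y + ((1 + snd y $ i $ j - det (snd y)) / cofactor i j (snd y)) *\<^sub>R e" for y
  define L where "L = {x. e \<bullet> x = 0}"
  have inner_e: "e \<bullet> x = snd x $ i $ j" for x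
    by (simp add: e_def inner_prod_def inner_axis')
  have shift: "det (snd (x + t *\<^sub>R e)) = det (snd x) + t * cofactor i j (snd x)"
    "cofactor i j (snd (x + t *\<^sub>R e)) = cofactor i j (snd x)"
    "snd (x + t *\<^sub>R e) $ i $ j = snd x $ i $ j + t" for x t
    by (simp_all add: e_def det_add_entry cofactor_add_entry)
  have "open U"
  proof -
    have "Cinf_on UNIV (\<lambda>x :: (real ^ 'n) \<times> (real ^ 'n ^ 'n). cofactor i j (snd x))"
      by (intro Cinf_on_cofactor Cinf_on_snd Cinf_on_ident open_UNIV)
    then show ?thesis
      unfolding U_def by (intro open_Collect_neq continuous_intros Cinf_on_continuous_on)
  qed
  have smooth: "Cinf_on U \<phi>" "Cinf_on U \<psi>"
    unfolding \<phi>_def \<psi>_def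
    by (intro Cinf_on_add Cinf_on_bilinear[OF _ bounded_bilinear_scaleR] Cinf_on_diff Cinf_on_divide
        Cinf_on_det Cinf_on_cofactor Cinf_on_nth Cinf_on_snd Cinf_on_const Cinf_on_ident \<open>open U\<close>;
        simp add: U_def)+
  have maps: "\<phi> x \<in> U" "\<psi> x \<in> U" "\<psi> (\<phi> x) = x" "\<phi> (\<psi> x) = x" if "x \<in> U" for x
  proof -
    have C: "cofactor i j (snd x) \<noteq> 0" using that by (simp add: U_def)
    show "\<phi> x \<in> U" "\<psi> x \<in> U"
      unfolding U_def \<phi>_def \<psi>_def mem_Collect_eq shift by (rule C)+
    let ?a = "det (snd x) - 1 - snd x $ i $ j"
    have "\<psi> (\<phi> x) = x + (?a + (1 + (snd x $ i $ j + ?a) - (det (snd x) + ?a * cofactor i j (snd x))) /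
        cofactor i j (snd x)) *\<^sub>R e"
      unfolding \<psi>_def \<phi>_def shift by (simp only: scaleR_add_left add.assoc)
    also have "(1 + (snd x $ i $ j + ?a) - (det (snd x) + ?a * cofactor i j (snd x))) / cofactor i j (snd x) = - ?a"
      using C by (simp add: field_simps)
    finally show "\<psi> (\<phi> x) = x" by simp
    let ?b = "(1 + snd x $ i $ j - det (snd x)) / cofactor i j (snd x)"
    have "\<phi> (\<psi> x) = x + (?b + (det (snd x) + ?b * cofactor i j (snd x) - 1 - (snd x $ i $ j + ?b))) *\<^sub>R e"
      unfolding \<psi>_def \<phi>_def shift by (simp only: scaleR_add_left add.assoc)
    also have "?b + (det (snd x) + ?b * cofactor i j (snd x) - 1 - (snd x $ i $ j + ?b)) = 0"
      using C by simp
    finally show "\<phi> (\<psi> x) = x" by simp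
  qed
  have homeo: "homeomorphism U U \<phi> \<psi>"
    using maps smooth by (intro homeomorphismI Cinf_on_continuous_on) auto
  have "dim L = ?d"
    unfolding L_def by (rule dim_hyperplane) (simp add: e_def zero_prod_def axis_eq_0_iff)
  moreover have "subspace L"
    unfolding L_def by (rule subspace_hyperplane)
  moreover have "\<phi> ` (?M \<inter> U) = L \<inter> U"
  proof (intro subset_antisym subsetI)
    fix y assume "y \<in> \<phi> ` (?M \<inter> U)"
    then obtain x where x: "x \<in> ?M" "x \<in> U" "y = \<phi> x" by blast
    have "snd (\<phi> x) $ i $ j = det (snd x) - 1"
      unfolding \<phi>_def shift by simp
    with x maps(1)[OF x(2)] show "y \<in> L \<inter> U"
      by (simp add: L_def inner_e carrier_special_affine_group)
  next
    fix y assume y: "y \<in> L \<inter> U"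
    then have "snd y $ i $ j = 0" "cofactor i j (snd y) \<noteq> 0"
      by (auto simp: L_def U_def inner_e)
    then have "det (snd (\<psi> y)) = 1"
      unfolding \<psi>_def shift by simp
    then show "y \<in> \<phi> ` (?M \<inter> U)"
      using y maps[of y] by (intro image_eqI[of _ _ "\<psi> y"]) (auto simp: carrier_special_affine_group)
  qed
  ultimately show "\<exists>U V \<phi> \<psi> (L :: ((real ^ 'n) \<times> (real ^ 'n ^ 'n)) set).
       open U \<and> p \<in> U \<and> open V \<and> homeomorphism U V \<phi> \<psi> \<and> Cinf_on U \<phi> \<and> Cinf_on V \<psi> \<and>
       subspace L \<and> dim L = ?d \<and> \<phi> ` (?M \<inter> U) = L \<inter> V"
    using \<open>open U\<close> ij homeo smooth by (intro exI[of _ U] exI[of _ \<phi>] exI[of _ \<psi>] exI[of _ L]) (simp add: U_def)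
qed

lemma lie_group_special_affine_group:
  "lie_group (DIM((real ^ 'n) \<times> (real ^ 'n ^ 'n)) - 1)
    (special_affine_group :: ((real ^ 'n) \<times> (real ^ 'n ^ 'n)) monoid)" (is "lie_group _ ?G")
  unfolding lie_group_def
proof (intro conjI)
  have "Cinf_on UNIV (\<lambda>z :: ((real ^ 'n) \<times> (real ^ 'n ^ 'n)) \<times> ((real ^ 'n) \<times> (real ^ 'n ^ 'n)).
      (fst (fst z), 0) + lmul (snd (fst z)) (snd z))"
    by (intro Cinf_on_add Cinf_on_Pair Cinf_on_bilinear[OF _ bounded_bilinear_lmul] Cinf_on_fst Cinf_on_snd
        Cinf_on_const Cinf_on_ident open_UNIV)
  then show "smooth_map_on (carrier ?G \<times> carrier ?G) (\<lambda>(x, y). x \<otimes>\<^bsub>?G\<^esub> y)"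
    unfolding smooth_map_on_def mult_special_affine_group case_prod_unfold by blast
next
  let ?U = "{x :: (real ^ 'n) \<times> (real ^ 'n ^ 'n). det (snd x) \<noteq> 0}"
  have "Cinf_on ?U affine_inverse"
    unfolding affine_inverse_def
    by (intro Cinf_on_Pair Cinf_on_uminus Cinf_on_matrix_vector_mult Cinf_on_matrix_inv Cinf_on_fst Cinf_on_snd
        Cinf_on_ident open_snd_det_nonzero) auto
  then show "smooth_map_on (carrier ?G) (\<lambda>x. inv\<^bsub>?G\<^esub> x)"
    unfolding smooth_map_on_def
    by (intro ballI exI[of _ ?U] exI[of _ affine_inverse] conjI open_snd_det_nonzero)
      (simp_all add: inv_special_affine_group carrier_special_affine_group)
qed (rule group_special_affine_group embedded_submanifold_special_affine_group)+

section \<open>Tangent vectors\<close>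

text \<open>Differentiating the Leibniz formula leaves products of all but one of the entries of the
  identity matrix at positions \<open>(j, \<sigma> j)\<close>. A permutation fixing all but one index is the
  identity, so only the diagonal terms survive.\<close>

lemma has_real_derivative_det_at_one:
  fixes B :: "real ^ 'n ^ 'n"
  shows "((\<lambda>t. det (mat 1 + t *\<^sub>R B)) has_real_derivative trace B) (at 0)"
proof -
  let ?P = "{\<sigma>. \<sigma> permutes (UNIV :: 'n set)}"
  let ?\<delta> = "\<lambda>i j. (mat 1 :: real ^ 'n ^ 'n) $ i $ j"
  let ?T = "\<lambda>\<sigma>. \<Sum>i\<in>UNIV. B $ i $ \<sigma> i * (\<Prod>j\<in>UNIV - {i}. ?\<delta> j (\<sigma> j))"
  have "((\<lambda>t. \<Prod>i\<in>UNIV. ?\<delta> i (\<sigma> i) + t * B $ i $ \<sigma> i) has_real_derivative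
      (\<Sum>i\<in>UNIV. B $ i $ \<sigma> i * (\<Prod>j\<in>UNIV - {i}. ?\<delta> j (\<sigma> j) + 0 * B $ j $ \<sigma> j))) (at 0)" for \<sigma>
    by (rule has_field_derivative_prod) (auto intro!: derivative_eq_intros)
  then have "((\<lambda>t. det (mat 1 + t *\<^sub>R B)) has_real_derivative
      (\<Sum>\<sigma>\<in>?P. of_int (sign \<sigma>) * ?T \<sigma>)) (at 0)"
    unfolding det_def by (auto intro!: DERIV_sum DERIV_cmult)
  moreover have "?T \<sigma> = (if \<sigma> = id then trace B else 0)" if "\<sigma> permutes UNIV" for \<sigma> :: "'n \<Rightarrow> 'n"
  proof (cases "\<sigma> = id")
    case True
    then show ?thesis by (simp add: mat_def trace_def)
  next
    case False
    have "(\<Prod>j\<in>UNIV - {i}. ?\<delta> j (\<sigma> j)) = 0" for i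
    proof (rule ccontr)
      assume "(\<Prod>j\<in>UNIV - {i}. ?\<delta> j (\<sigma> j)) \<noteq> 0"
      then have "\<sigma> j = j" if "j \<noteq> i" for j
        using that by (auto simp: mat_def split: if_splits)
      then have "\<sigma> permutes {i}"
        using that by (auto simp: permutes_def)
      with False show False by (simp add: permutes_sing)
    qed
    with False show ?thesis by (simp only: mult_zero_right sum.neutral_const if_False)
  qed
  then have "(\<Sum>\<sigma>\<in>?P. of_int (sign \<sigma>) * ?T \<sigma>) = (\<Sum>\<sigma>\<in>?P. if \<sigma> = id then trace B else 0)"
    by (intro sum.cong) (auto simp: sign_id)
  ultimately show ?thesis
    by (simp add: finite_permutations permutes_id)
qed

text \<open>The tangent vector is realised by the left translate of the curve
  \<open>t \<mapsto> (t b, mat 1 + t B)\<close>, corrected to have determinant 1 by dividing one row by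
  \<open>det (mat 1 + t B)\<close>. As \<open>trace B = 0\<close>, this factor is 1 to first order and does not change the
  velocity at 0.\<close>

lemma left_translate_traceless_tangent:
  fixes p X :: "(real ^ 'n) \<times> (real ^ 'n ^ 'n)"
  assumes p: "p \<in> carrier special_affine_group" and X: "X \<in> traceless"
  shows "lmul (snd p) X \<in> tangent_space (carrier special_affine_group) p"
proof -
  define i :: 'n where "i = undefined"
  \<comment> \<open>\<open>N\<close> keeps row \<open>i\<close> only, so that \<open>R t\<close> is \<open>mat 1 + t B\<close> with row \<open>i\<close> divided by \<open>d t\<close>.\<close>
  define N where "N A = (\<chi> k. if k = i then A $ k else 0)" for A :: "real ^ 'n ^ 'n"
  define B where "B = snd X"
  define d where "d t = det (mat 1 + t *\<^sub>R B)" for t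
  define R where "R t = mat 1 + t *\<^sub>R B + (inverse (d t) - 1) *\<^sub>R (N (mat 1) + t *\<^sub>R N B)" for t
  define \<gamma> where "\<gamma> t = (fst p, 0) + lmul (snd p) (t *\<^sub>R fst X, R t)" for t
  have d0: "d 0 = 1" by (simp add: d_def)
  have smooth_d: "Cinf_on S d" if "open S" for S
    unfolding d_def by (intro Cinf_on_det Cinf_on_add Cinf_on_const Cinf_on_ident
        Cinf_on_bilinear[OF _ bounded_bilinear_scaleR] that)
  have "isCont d 0"
    using Cinf_on_continuous_on[OF smooth_d[OF open_UNIV]] by (simp add: continuous_on_eq_continuous_at)
  then obtain \<epsilon> where \<epsilon>: "\<epsilon> > 0" "\<And>t. dist t 0 < \<epsilon> \<Longrightarrow> d t \<noteq> 0"
    using continuous_at_avoid[of 0 d 0] d0 by (auto simp: dist_commute)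
  let ?I = "{-\<epsilon><..<\<epsilon>}"
  have dI: "d t \<noteq> 0" if "t \<in> ?I" for t
    using \<epsilon>(2) that by (auto simp: dist_real_def)
  have detR: "det (R t) = 1" if "t \<in> ?I" for t
  proof -
    let ?A = "mat 1 + t *\<^sub>R B"
    have "R t = row_replace i ?A (inverse (d t) *\<^sub>R ?A $ i)"
      by (auto simp: R_def N_def row_replace_def vec_eq_iff algebra_simps)
    then have "det (R t) = inverse (d t) * det ?A"
      by (simp only: linear_scale[OF linear_det_row_replace] row_replace_same real_scaleR_def)
    then show ?thesis using dI[OF that] by (simp add: d_def)
  qed
  have "Cinf_on ?I \<gamma>"
  proof -
    have "Cinf_on ?I (\<lambda>t. inverse (d t))"
      unfolding inverse_eq_divide by (rule Cinf_on_divide) (use dI in \<open>auto intro: Cinf_on_const smooth_d\<close>)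
    then show ?thesis
      unfolding \<gamma>_def R_def
      by (intro Cinf_on_add Cinf_on_bilinear[OF _ bounded_bilinear_lmul] Cinf_on_bilinear[OF _ bounded_bilinear_scaleR]
        Cinf_on_Pair Cinf_on_diff Cinf_on_const Cinf_on_ident) auto
  qed
  moreover have "\<gamma> ` ?I \<subseteq> carrier special_affine_group"
    using p detR by (auto simp: carrier_special_affine_group \<gamma>_def lmul_def det_mul)
  moreover have "\<gamma> 0 = p"
    by (simp add: \<gamma>_def R_def d0 lmul_def)
  ultimately have "smooth_curve_through (carrier special_affine_group) p \<gamma>"
    using \<epsilon>(1) by (auto simp: smooth_curve_through_def)
  moreover have "vector_derivative \<gamma> (at 0) = lmul (snd p) X"
  proof -
    have "(d has_real_derivative 0) (at 0)"
      using has_real_derivative_det_at_one[of B] X unfolding d_def by (simp add: traceless_def B_def)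
    then have g: "((\<lambda>t. inverse (d t) - 1) has_real_derivative 0) (at 0)"
      using d0 by (auto intro!: derivative_eq_intros)
    have lin: "((\<lambda>t. X + t *\<^sub>R Y) has_vector_derivative Y) (at 0)" for X Y :: "real ^ 'n ^ 'n"
      by (auto intro!: derivative_eq_intros)
    have "(R has_vector_derivative B) (at 0)"
      unfolding R_def using has_vector_derivative_add[OF lin has_vector_derivative_scaleR[OF g lin]] d0 by simp
    then have "((\<lambda>t. (t *\<^sub>R fst X, R t)) has_vector_derivative (fst X, B)) (at 0)"
      by (intro has_vector_derivative_Pair) (auto intro!: derivative_eq_intros)
    from bounded_linear.has_vector_derivative[OF bounded_bilinear.bounded_linear_right[OF bounded_bilinear_lmul] this]
    have "(\<gamma> has_vector_derivative lmul (snd p) (fst X, B)) (at 0)"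
      unfolding \<gamma>_def by (auto intro!: derivative_eq_intros)
    then show ?thesis by (simp add: vector_derivative_at B_def)
  qed
  ultimately show ?thesis
    unfolding tangent_space_def by force
qed

section \<open>The left invariant form and its exterior derivative\<close>

definition left_invariant_form ::
  "('n \<Rightarrow> real) \<Rightarrow> (real ^ 'n) \<times> (real ^ 'n ^ 'n) \<Rightarrow> (real ^ 'n) \<times> (real ^ 'n ^ 'n) \<Rightarrow> real"
  where "left_invariant_form m p v = lmul (matrix_inv (snd p)) v \<bullet> contact_covector m"

lemma bounded_linear_form_arg: "bounded_linear (\<lambda>J. lmul J v \<bullet> contact_covector m)"
  by (intro bounded_linear_inner_left_comp bounded_bilinear.bounded_linear_left[OF bounded_bilinear_lmul])

lemma local_extension_left_invariant_form:
  fixes m :: "'n::finite \<Rightarrow> real"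
  assumes "p \<in> carrier special_affine_group"
  shows "local_extension (carrier special_affine_group) (left_invariant_form m) p
    {x. det (snd x) \<noteq> 0} (left_invariant_form m)"
  unfolding local_extension_def smooth_1form_on_open_def left_invariant_form_def
proof (intro conjI ballI allI)
  fix v
  show "Cinf_on {x :: (real ^ 'n) \<times> (real ^ 'n ^ 'n). det (snd x) \<noteq> 0}
      (\<lambda>x. lmul (matrix_inv (snd x)) v \<bullet> contact_covector m)"
    by (intro Cinf_on_linear_compose[OF _ bounded_linear_form_arg] Cinf_on_matrix_inv Cinf_on_snd Cinf_on_ident
        open_snd_det_nonzero) auto
next
  fix x show "linear (\<lambda>v. lmul (matrix_inv (snd x)) v \<bullet> contact_covector m)"
    by (intro bounded_linear.linear bounded_linear_inner_left_comp
        bounded_bilinear.bounded_linear_right[OF bounded_bilinear_lmul] bounded_linear_ident)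
  show "open {x :: (real ^ 'n) \<times> (real ^ 'n ^ 'n). det (snd x) \<noteq> 0}"
    by (rule open_snd_det_nonzero)
qed (use assms in \<open>auto simp: carrier_special_affine_group\<close>)

lemma left_invariant_1form_left_invariant_form:
  fixes m :: "'n::finite \<Rightarrow> real"
  shows "left_invariant_1form special_affine_group (left_invariant_form m)"
  unfolding left_invariant_1form_def
proof (intro ballI allI impI)
  fix g p :: "(real ^ 'n) \<times> (real ^ 'n ^ 'n)" and \<gamma>
  assume g: "g \<in> carrier special_affine_group" and p: "p \<in> carrier special_affine_group"
    and "smooth_curve_through (carrier special_affine_group) p \<gamma>"
  then obtain \<epsilon> where "\<epsilon> > 0" "Cinf_on {-\<epsilon><..<\<epsilon>} \<gamma>"
    by (auto simp: smooth_curve_through_def)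
  then have "\<gamma> differentiable (at 0)"
    using Cinf_on_has_derivative[of "{-\<epsilon><..<\<epsilon>}" \<gamma> 0] by (auto simp: differentiable_def)
  then have "(\<gamma> has_vector_derivative vector_derivative \<gamma> (at 0)) (at 0)"
    by (simp add: vector_derivative_works)
  from bounded_linear.has_vector_derivative[OF bounded_bilinear.bounded_linear_right[OF bounded_bilinear_lmul] this]
  have "((\<lambda>t. g \<otimes>\<^bsub>special_affine_group\<^esub> \<gamma> t) has_vector_derivative lmul (snd g) (vector_derivative \<gamma> (at 0))) (at 0)"
    unfolding mult_special_affine_group by (auto intro!: derivative_eq_intros)
  moreover have "matrix_inv (snd g ** snd p) ** snd g = matrix_inv (snd p)"
    using g p by (simp add: carrier_special_affine_group matrix_inv_mult flip: matrix_mul_assoc)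
      (simp add: matrix_inv_cancel)
  ultimately show "left_invariant_form m (g \<otimes>\<^bsub>special_affine_group\<^esub> p)
      (vector_derivative (\<lambda>t. g \<otimes>\<^bsub>special_affine_group\<^esub> \<gamma> t) (at 0)) =
      left_invariant_form m p (vector_derivative \<gamma> (at 0))"
    by (simp add: vector_derivative_at left_invariant_form_def lmul_mult mult_special_affine_group lmul_def[of _ p])
qed

text \<open>This is \<open>d\<eta>(X, Y) = - \<eta>([X, Y])\<close> for left invariant fields. The two terms of the bracket
  come from the derivative \<open>- A\<^sup>-\<^sup>1 H A\<^sup>-\<^sup>1\<close> of the matrix inverse in the direction \<open>H\<close>.\<close>

lemma ext_deriv_left_invariant_form:
  assumes "det (snd p) \<noteq> 0"
  shows "ext_deriv_1form (left_invariant_form m) p v =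
    bracket_form m (lmul (matrix_inv (snd p)) (v 0)) (lmul (matrix_inv (snd p)) (v 1))"
proof -
  let ?J = "matrix_inv (snd p)"
  have "frechet_derivative (\<lambda>x. left_invariant_form m x y) (at p) x =
      - (lmul (snd (lmul ?J x)) (lmul ?J y) \<bullet> contact_covector m)" for x y
  proof -
    have "((\<lambda>q. matrix_inv (snd q)) has_derivative (\<lambda>h. - (?J ** snd h ** ?J))) (at p)"
      using has_derivative_compose[OF has_derivative_snd[OF has_derivative_ident] has_derivative_matrix_inv[OF assms]]
      by simp
    from bounded_linear.has_derivative[OF bounded_linear_form_arg[of y m] this]
    have "((\<lambda>q. left_invariant_form m q y) has_derivative (\<lambda>h. lmul (- (?J ** snd h ** ?J)) y \<bullet> contact_covector m)) (at p)"
      by (simp add: left_invariant_form_def)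
    from frechet_derivative_at[OF this, symmetric] show ?thesis
      by (simp add: lmul_mult bounded_bilinear.minus_left[OF bounded_bilinear_lmul] lmul_def[of _ x])
  qed
  then show ?thesis
    by (simp add: ext_deriv_1form_def bracket_form_def inner_diff_left)
qed

section \<open>The contact condition\<close>

lemma traceless_hyperplane:
  "(traceless :: ((real ^ 'n) \<times> (real ^ 'n ^ 'n)) set) = {x. (0, mat 1) \<bullet> x = 0}"
proof -
  have "(\<Sum>j\<in>UNIV. (mat 1 :: real ^ 'n ^ 'n) $ i $ j * A $ i $ j) = A $ i $ i" for A :: "real ^ 'n ^ 'n" and i
    by (simp add: mat_def if_distrib[of "\<lambda>x. x * _"] cong: if_cong)
  then show ?thesis
    by (auto simp: traceless_def trace_def inner_prod_def inner_vec_def)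
qed

text \<open>The Lie algebra is the direct sum of the kernel \<open>K\<close> of the functional and the line of the
  Reeb vector. The Reeb vector is orthogonal to the whole Lie algebra with respect to
  \<open>bracket_form m\<close>, so a vector of \<open>K\<close> orthogonal to \<open>K\<close> is in the radical and thus a multiple of
  the Reeb vector, hence zero. So \<open>K\<close> has a symplectic basis and even dimension.\<close>

lemma adapted_basis_exists:
  fixes m :: "'n::finite \<Rightarrow> real"
  assumes "inj m"
  shows "\<exists>k u. DIM((real ^ 'n) \<times> (real ^ 'n ^ 'n)) - 1 = 2 * k + 1 \<and> (\<forall>a<2 * k + 1. u a \<in> traceless) \<and>
    (\<forall>a<2 * k. \<forall>b<2 * k. bracket_form m (u a) (u b) = darboux a b) \<and>
    (\<forall>a<2 * k. u a \<bullet> contact_covector m = 0) \<and> u (2 * k) \<bullet> contact_covector m \<noteq> 0"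
proof -
  let ?w = "reeb m" and ?T = "traceless :: ((real ^ 'n) \<times> (real ^ 'n ^ 'n)) set"
  have w: "?w \<bullet> contact_covector m \<noteq> 0" using inner_reeb_covector_pos[OF assms] by simp
  then have w0: "?w \<noteq> 0" by auto
  have T: "subspace ?T"
    unfolding traceless_hyperplane by (rule subspace_hyperplane)
  have dimT: "dim ?T = DIM((real ^ 'n) \<times> (real ^ 'n ^ 'n)) - 1"
  proof -
    have "(mat 1 :: real ^ 'n ^ 'n) \<noteq> 0"
      by (metis det_I det_0 zero_neq_one mat_0)
    then show ?thesis
      unfolding traceless_hyperplane by (intro dim_hyperplane) (simp add: zero_prod_def)
  qed
  define K where "K = {x \<in> ?T. x \<bullet> contact_covector m = 0}"
  have K: "subspace K"
    using T by (auto simp: K_def subspace_def inner_add_left)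
  \<comment> \<open>The projection onto \<open>K\<close> along the Reeb vector.\<close>
  define \<pi> where "\<pi> x = x - ((x \<bullet> contact_covector m) / (?w \<bullet> contact_covector m)) *\<^sub>R ?w" for x
  have \<pi>K: "\<pi> x \<in> K" if "x \<in> ?T" for x
    using that w T reeb_traceless by (auto simp: K_def \<pi>_def inner_diff_left intro!: subspace_diff subspace_scale)
  note [simp] = bilinear_radd[OF bilinear_bracket_form] bilinear_rmul[OF bilinear_bracket_form]
    bilinear_rsub[OF bilinear_bracket_form]
  have anti: "bracket_form m x y = - bracket_form m y x" for x y
    by (simp add: bracket_form_def inner_diff_left)
  have nd: "\<exists>y\<in>K. bracket_form m x y \<noteq> 0" if x: "x \<in> K" "x \<noteq> 0" for x
  proof (rule ccontr)
    assume "\<not> ?thesis"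
    then have z: "bracket_form m x y = 0" if "y \<in> K" for y using that by blast
    have xw: "bracket_form m x ?w = 0"
      using anti[of x ?w] reeb_radical[OF assms] x by (simp add: K_def)
    have "bracket_form m x y = 0" if "y \<in> ?T" for y
      using z[OF \<pi>K[OF that]] by (simp add: \<pi>_def xw)
    then obtain s where s: "x = s *\<^sub>R ?w"
      using bracket_form_radical[OF assms] by blast
    then have "s * (?w \<bullet> contact_covector m) = 0" using x by (simp add: K_def)
    with w x s show False by simp
  qed
  obtain k u where u: "dim K = 2 * k" "\<forall>a<2 * k. u a \<in> K"
    "\<forall>a<2 * k. \<forall>b<2 * k. bracket_form m (u a) (u b) = darboux a b"
    using symplectic_basis_exists[OF bilinear_bracket_form bracket_form_self K nd] by auto
  have sum: "{x + y |x y. x \<in> K \<and> y \<in> span {?w}} = ?T"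
  proof (intro subset_antisym subsetI)
    fix z assume "z \<in> {x + y |x y. x \<in> K \<and> y \<in> span {?w}}"
    then obtain x y where "z = x + y" "x \<in> K" "y \<in> span {?w}" by blast
    moreover have "span {?w} \<subseteq> ?T"
      using T reeb_traceless by (intro span_minimal) auto
    ultimately show "z \<in> ?T"
      using T by (auto simp only: K_def intro!: subspace_add)
  next
    fix z assume "z \<in> ?T"
    have "z = \<pi> z + ((z \<bullet> contact_covector m) / (?w \<bullet> contact_covector m)) *\<^sub>R ?w" by (simp add: \<pi>_def)
    with \<pi>K[OF \<open>z \<in> ?T\<close>] show "z \<in> {x + y |x y. x \<in> K \<and> y \<in> span {?w}}"
      by (blast intro: span_base span_scale)
  qed
  have "K \<inter> span {?w} = {0}"
    using w subspace_0[OF K] by (auto simp: K_def span_singleton)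
  then have "dim ?T = 2 * k + 1"
    using dim_sums_Int[OF K subspace_span[of "{?w}"], unfolded sum] w0 u(1) by simp
  then show ?thesis
    using u w dimT reeb_traceless
    by (intro exI[of _ k] exI[of _ "\<lambda>a. if a < 2 * k then u a else ?w"]) (auto simp: K_def)
qed

theorem proposition2:
  shows "contact_lie_group (special_affine_group :: ((real ^ 'n) \<times> (real ^ 'n ^ 'n)) monoid)"
proof -
  let ?G = "special_affine_group :: ((real ^ 'n) \<times> (real ^ 'n ^ 'n)) monoid"
  obtain m :: "'n \<Rightarrow> real" where m: "inj m"
  proof -
    obtain f :: "'n \<Rightarrow> nat" where "inj f"
      using finite_imp_inj_to_nat_seg[of "UNIV :: 'n set"] by auto
    then have "inj (\<lambda>i. real (f i))" by (auto simp: inj_on_def)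
    then show ?thesis by (rule that)
  qed
  obtain k and u where k: "DIM((real ^ 'n) \<times> (real ^ 'n ^ 'n)) - 1 = 2 * k + 1"
    and u: "\<And>a. a < 2 * k + 1 \<Longrightarrow> u a \<in> traceless"
      "\<And>a b. a < 2 * k \<Longrightarrow> b < 2 * k \<Longrightarrow> bracket_form m (u a) (u b) = darboux a b"
      "\<And>a. a < 2 * k \<Longrightarrow> u a \<bullet> contact_covector m = 0" "u (2 * k) \<bullet> contact_covector m \<noteq> 0"
    using adapted_basis_exists[OF m] by blast
  let ?\<eta> = "left_invariant_form m"
  let ?\<theta> = "ext_deriv_1form ?\<eta>"
  have "nonzero_form_at (carrier ?G) p (2 * k + 1)
      (wedge (2 * k) 1 (wedge_power 2 (?\<theta> p) k) (\<lambda>v. ?\<eta> p (v 0)))" if p: "p \<in> carrier ?G" for p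
  proof -
    have d: "det (snd p) \<noteq> 0" using p by (simp add: carrier_special_affine_group)
    let ?J = "matrix_inv (snd p)" and ?v = "\<lambda>a. lmul (snd p) (u a)"
    let ?\<Omega> = "\<lambda>x y. bracket_form m (lmul ?J x) (lmul ?J y)"
    have \<theta>: "?\<theta> p = (\<lambda>v. ?\<Omega> (v 0) (v 1))"
      by (rule ext) (rule ext_deriv_left_invariant_form[OF d])
    have cancel: "lmul ?J (?v a) = u a" for a
      by (simp add: lmul_mult matrix_inv_cancel d lmul_one)
    have "wedge (2 * k) 1 (wedge_power 2 (\<lambda>v. ?\<Omega> (v 0) (v 1)) k) (\<lambda>v. ?\<eta> p (v 0)) ?v \<noteq> 0"
      by (rule contact_form_nonzero) (simp_all add: left_invariant_form_def cancel u)
    then show ?thesis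
      unfolding nonzero_form_at_def \<theta>
      using left_translate_traceless_tangent[OF p u(1)] by (intro exI[of _ ?v] conjI allI impI)
  qed
  moreover have "smooth_1form_on (carrier ?G) ?\<eta>" "has_ext_deriv (carrier ?G) ?\<eta> ?\<theta>"
    unfolding smooth_1form_on_def has_ext_deriv_def
    using local_extension_left_invariant_form[of _ m] by blast+
  ultimately show ?thesis
    unfolding contact_lie_group_def
    using lie_group_special_affine_group[where 'n = 'n] left_invariant_1form_left_invariant_form[of m]
    unfolding k by (intro exI[of _ k] exI[of _ ?\<eta>] exI[of _ ?\<theta>] conjI ballI)
qed

end
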